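(* Let $n\ge 1$, let $k$ be a field, $S=k[x_1,\ldots,x_n]$, and let $M$ be a monomial ideal of $S$. If $\operatorname{pd}(S/M)=n$, then $\sum_{i=0}^n \operatorname{b}_i(S/M)\ge 2^n$.
   Context: $\operatorname{b}_i(S/M)$ is the $i$-th Betti number of $S/M$, i.e. the rank of the $i$-th free module of a minimal (multigraded) free resolution of $S/M$ over $S$; $\operatorname{pd}(S/M)=\max\{i:\operatorname{b}_i(S/M)\neq 0\}$ is the projective dimension. *)

theory Defs
  imports
    "HOL-Library.Poly_Mapping"
    "HOL-Library.Cardinality"
    "HOL-Library.Extended_Nat"
    "Jordan_Normal_Form.Matrix_Kernel"
begin

text \<open>
  The polynomial ring \<open>S\<close> over \<open>'k\<close> has one variable per element of the finite type \<open>'n\<close>,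
  so that \<open>n = CARD('n) \<ge> 1\<close>. A multidegree (exponent vector) is an element of \<open>'n \<Rightarrow>\<^sub>0 nat\<close>.
\<close>

type_synonym ('n, 'k) mpoly = "('n \<Rightarrow>\<^sub>0 nat) \<Rightarrow>\<^sub>0 'k"

definition monom_of :: "('n \<Rightarrow>\<^sub>0 nat) \<Rightarrow> ('n, 'k::field) mpoly" where
  "monom_of a = Poly_Mapping.single a 1"

definition ideal_gen :: "('n, 'k::field) mpoly set \<Rightarrow> ('n, 'k) mpoly set" where
  "ideal_gen = Modules.module.span (*)"

definition monomial_ideal :: "('n, 'k::field) mpoly set \<Rightarrow> bool" where
  "monomial_ideal M \<longleftrightarrow> (\<exists>A. M = ideal_gen (monom_of ` A))"

text \<open>The homogeneous maximal ideal \<open>(x\<^sub>1, \<dots>, x\<^sub>n)\<close>.\<close>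

definition max_ideal :: "('n, 'k::field) mpoly set" where
  "max_ideal = ideal_gen (range (\<lambda>i. monom_of (Poly_Mapping.single i 1)))"

definition mat_image :: "'a::comm_ring_1 mat \<Rightarrow> 'a vec set" where
  "mat_image A = (\<lambda>v. A *\<^sub>v v) ` carrier_vec (dim_col A)"

text \<open>
  A free resolution
  \<open>\<dots> \<rightarrow> S\<^bsup>\<beta> 2\<^esup> \<rightarrow> S\<^bsup>\<beta> 1\<^esup> \<rightarrow> S\<^bsup>\<beta> 0\<^esup> \<rightarrow> S/M \<rightarrow> 0\<close>
  by free modules of finite rank, with bases chosen: the matrix \<open>d i\<close> gives the differential
  from the free module in homological degree \<open>i + 1\<close> to that in degree \<open>i\<close>. The augmentation
  onto \<open>S/M\<close> sends the \<open>j\<close>-th basis vector to the class of \<open>u $ j\<close>, hence \<open>v\<close> to the class of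
  \<open>u \<bullet> v\<close>; every linear map from a free module to \<open>S/M\<close> has this form.
\<close>

definition free_resolution ::
  "('n, 'k::field) mpoly set \<Rightarrow> (nat \<Rightarrow> nat) \<Rightarrow> (nat \<Rightarrow> ('n, 'k) mpoly mat)
    \<Rightarrow> ('n, 'k) mpoly vec \<Rightarrow> bool" where
  "free_resolution M \<beta> d u \<longleftrightarrow>
     u \<in> carrier_vec (\<beta> 0) \<and>
     (\<forall>i. d i \<in> carrier_mat (\<beta> i) (\<beta> (Suc i))) \<and>
     (\<forall>s. \<exists>v\<in>carrier_vec (\<beta> 0). s - u \<bullet> v \<in> M) \<and>
     mat_image (d 0) = {v \<in> carrier_vec (\<beta> 0). u \<bullet> v \<in> M} \<and>
     (\<forall>i. mat_image (d (Suc i)) = mat_kernel (d i))"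

text \<open>
  \<open>g i c\<close> is the multidegree of the \<open>c\<close>-th basis vector in homological degree \<open>i\<close>. All maps are
  homogeneous of degree zero, so an entry of \<open>d i\<close> in row \<open>r\<close>, column \<open>c\<close> can only contain the
  monomial of exponent \<open>t\<close> with \<open>g i r + t = g (i + 1) c\<close>. The lift \<open>u $ c\<close> of the image of a
  basis vector under the augmentation can always be chosen homogeneous.
\<close>

definition multigraded ::
  "(nat \<Rightarrow> nat) \<Rightarrow> (nat \<Rightarrow> ('n, 'k::field) mpoly mat) \<Rightarrow> ('n, 'k) mpoly vec
    \<Rightarrow> (nat \<Rightarrow> nat \<Rightarrow> ('n \<Rightarrow>\<^sub>0 nat)) \<Rightarrow> bool" where
  "multigraded \<beta> d u g \<longleftrightarrow>
     (\<forall>c<\<beta> 0. \<forall>t\<in>Poly_Mapping.keys (u $ c). t = g 0 c) \<and>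
     (\<forall>i. \<forall>r<\<beta> i. \<forall>c<\<beta> (Suc i). \<forall>t\<in>Poly_Mapping.keys (d i $$ (r, c)). g i r + t = g (Suc i) c)"

text \<open>Minimality: each differential maps into the maximal ideal times the next free module.\<close>

definition minimal_differentials ::
  "(nat \<Rightarrow> nat) \<Rightarrow> (nat \<Rightarrow> ('n, 'k::field) mpoly mat) \<Rightarrow> bool" where
  "minimal_differentials \<beta> d \<longleftrightarrow>
     (\<forall>i. \<forall>r<\<beta> i. \<forall>c<\<beta> (Suc i). d i $$ (r, c) \<in> max_ideal)"

definition minimal_multigraded_resolution ::
  "('n, 'k::field) mpoly set \<Rightarrow> (nat \<Rightarrow> nat) \<Rightarrow> (nat \<Rightarrow> ('n, 'k) mpoly mat)
    \<Rightarrow> ('n, 'k) mpoly vec \<Rightarrow> (nat \<Rightarrow> nat \<Rightarrow> ('n \<Rightarrow>\<^sub>0 nat)) \<Rightarrow> bool" where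
  "minimal_multigraded_resolution M \<beta> d u g \<longleftrightarrow>
     free_resolution M \<beta> d u \<and> multigraded \<beta> d u g \<and> minimal_differentials \<beta> d"

text \<open>
  The Betti numbers of \<open>S/M\<close> are the ranks in a chosen minimal multigraded free resolution. For
  a monomial ideal one exists, and its ranks do not depend on the choice.
\<close>

definition betti :: "('n, 'k::field) mpoly set \<Rightarrow> nat \<Rightarrow> nat" where
  "betti M = (SOME \<beta>. \<exists>d u g. minimal_multigraded_resolution M \<beta> d u g)"

text \<open>
  The projective dimension of \<open>S/M\<close>. The supremum is taken in \<open>enat\<close> so that a finite nonzero
  value is an attained maximum; the zero module gets the value \<open>0\<close>.
\<close>

definition proj_dim :: "('n, 'k::field) mpoly set \<Rightarrow> enat" where
  "proj_dim M = Sup (enat ` {i. betti M i \<noteq> 0})"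

end

theory Submission
  imports Defs "HOL-Library.Countable" "HOL-Library.Function_Algebras"
begin

text \<open>
Everything happens one multidegree at a time. All maps of a multigraded resolution are homogeneous, so
in degree \<open>b\<close> a free module with basis degrees \<open>G c\<close> is the space of coefficient vectors supported on
the \<open>c\<close> with \<open>G c \<le> b\<close>, multiplication by a monomial is an inclusion of such spaces, and the
differentials are matrices over the field that do not depend on \<open>b\<close>. The locale \<open>scalar_resolution\<close>
is a minimal resolution in this form, \<open>I\<close> being the set of exponents of the monomials in \<open>M\<close>.

The lower bound comes from the double complex formed by the resolution \<open>F\<close> of \<open>S/M\<close> and the Koszul
complex of the variables. Suppose that \<open>F\<close> has a basis element in homological degree \<open>n\<close>, of
multidegree \<open>\<alpha>\<close>. By minimality a zigzag through the double complex in degree \<open>\<alpha>\<close> (\<open>zigzag\<close>) starts at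
this basis element and ends at a nonzero socle element of \<open>S/M\<close>: a monomial \<open>x\<^sup>\<mu>\<close> outside \<open>M\<close> all of
whose multiples \<open>x\<^sub>i x\<^sup>\<mu>\<close> lie in \<open>M\<close>, where \<open>\<mu> = \<alpha> - (1, \<dots>, 1)\<close> (\<open>socle_exponent\<close>). Now let \<open>A\<close> be any
set of variables. The zigzag in the opposite direction, with the Koszul complex of the variables in
\<open>A\<close>, starts at \<open>x\<^sup>\<mu>\<close>. If no basis element of \<open>F\<close> had a degree in the box given by \<open>b\<^sub>i = \<mu>\<^sub>i + 1\<close> for \<open>i\<close> in
\<open>A\<close> and \<open>b\<^sub>i \<le> \<mu>\<^sub>i\<close> for the other \<open>i\<close>, then the Koszul direction would be exact in the relevant degree
and the zigzag would show that \<open>x\<^sup>\<mu>\<close> is zero in \<open>S/M\<close>. So every one of the \<open>2\<^sup>n\<close> boxes contains the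
degree of a basis element (\<open>basis_element_in_box\<close>). The boxes are disjoint, and \<open>F\<close> has no basis elements
beyond homological degree \<open>n\<close> when the projective dimension is \<open>n\<close>, hence the total rank is at least \<open>2\<^sup>n\<close>.

The Betti numbers are the ranks in a chosen minimal resolution, so one has to exist. It is built by
choosing, again and again, a generating set of smallest cardinality for the kernel
(\<open>scalar_resolution_ex\<close>). Such a set is finite: the kernel in degree \<open>b\<close> can change only where \<open>b\<close> is a
join of basis degrees, and for \<open>M\<close> itself Dickson's lemma applies. The lemma \<open>mat_image_eq_iff\<close>
translates between exactness of polynomial matrices and exactness on all strands.
\<close>

section \<open>The zigzag in a double complex\<close>

text \<open>
Since \<open>f\<close> is exact away from \<open>p = 0\<close>, the element \<open>w\<close> can be moved along a staircase \<open>w = w\<^sub>0, w\<^sub>1, \<dots>\<close>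
with \<open>f w\<^sub>j\<^sub>+\<^sub>1 = h w\<^sub>j\<close> until it reaches \<open>z\<close> in the column \<open>q = 0\<close>. If \<open>z\<close> is in the image of \<open>h\<close>, exactness
of \<open>h\<close> away from \<open>q = 0\<close> lets the staircase be undone: correcting each \<open>w\<^sub>j\<close> by an image under \<open>f\<close> makes
it an image under \<open>h\<close>, so finally \<open>w\<close> is a sum of the two kinds of images. The argument is
formal, so the resolution and the Koszul complex can take either role. The conclusion about \<open>f z\<close>
records the last step of the staircase.
\<close>

lemma zigzag:
  fixes X :: "nat \<Rightarrow> nat \<Rightarrow> 'a::ab_group_add set" and f h :: "nat \<Rightarrow> 'a \<Rightarrow> 'a"
  assumes f_in: "\<And>p q x. x \<in> X (Suc p) q \<Longrightarrow> f p x \<in> X p q"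
    and h_in: "\<And>p q x. x \<in> X p (Suc q) \<Longrightarrow> h q x \<in> X p q"
    and diff_in: "\<And>p q x y. x \<in> X p q \<Longrightarrow> y \<in> X p q \<Longrightarrow> x - y \<in> X p q"
    and zero_in: "\<And>p q. 0 \<in> X p q"
    and f_diff: "\<And>p x y. f p (x - y) = f p x - f p y"
    and h_diff: "\<And>q x y. h q (x - y) = h q x - h q y"
    and comm: "\<And>p q x. x \<in> X (Suc p) (Suc q) \<Longrightarrow> f p (h q x) = h q (f p x)"
    and ff: "\<And>p q x. x \<in> X (Suc (Suc p)) q \<Longrightarrow> f p (f (Suc p) x) = 0"
    and hh: "\<And>p q x. x \<in> X p (Suc (Suc q)) \<Longrightarrow> h q (h (Suc q) x) = 0"
    and f_exact: "\<And>p q x. x \<in> X (Suc p) q \<Longrightarrow> f p x = 0 \<Longrightarrow> \<exists>y \<in> X (Suc (Suc p)) q. f (Suc p) y = x"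
    and h_exact: "\<And>p q x. x \<in> X p (Suc q) \<Longrightarrow> h q x = 0 \<Longrightarrow> \<exists>y \<in> X p (Suc (Suc q)). h (Suc q) y = x"
    and w: "w \<in> X p q"
    and start: "\<And>q'. q = Suc q' \<Longrightarrow> \<exists>y \<in> X (Suc p) q'. f p y = h q' w"
  shows "\<exists>z \<in> X (p + q) 0.
      (q = 0 \<longrightarrow> z = w) \<and>
      (\<forall>q'. q = Suc q' \<longrightarrow> (\<exists>y \<in> X (p + q') 1. f (p + q') z = h 0 y)) \<and>
      ((\<exists>v \<in> X (p + q) 1. z = h 0 v) \<longrightarrow> (\<exists>a \<in> X (Suc p) q. \<exists>b \<in> X p (Suc q). w = f p a + h q b))"
  using w start
proof (induction q arbitrary: p w)
  case 0
  have "f p 0 = 0" using f_diff[of p 0 0] by simp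
  then show ?case using 0 zero_in by (metis One_nat_def add.right_neutral add_0 old.nat.distinct(2))
next
  case (Suc q)
  from Suc.prems(2)[OF refl] obtain w1 where w1: "w1 \<in> X (Suc p) q" "f p w1 = h q w" by blast
  have "\<exists>y \<in> X (Suc (Suc p)) q'. f (Suc p) y = h q' w1" if q: "q = Suc q'" for q'
  proof (rule f_exact)
    show "h q' w1 \<in> X (Suc p) q'" using w1(1) h_in q by blast
    show "f p (h q' w1) = 0"
      using comm[of w1 p q'] w1 hh[of w p q'] Suc.prems(1) q by simp
  qed
  from Suc.IH[OF w1(1) this] obtain z where z: "z \<in> X (Suc p + q) 0" "q = 0 \<longrightarrow> z = w1"
      "\<And>q'. q = Suc q' \<Longrightarrow> \<exists>y \<in> X (Suc p + q') 1. f (Suc p + q') z = h 0 y"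
      "(\<exists>v \<in> X (Suc p + q) 1. z = h 0 v) \<Longrightarrow> \<exists>a \<in> X (Suc (Suc p)) q. \<exists>b \<in> X (Suc p) (Suc q). w1 = f (Suc p) a + h q b"
    by blast
  have "\<exists>y \<in> X (p + q) 1. f (p + q) z = h 0 y"
  proof (cases q)
    case 0
    then show ?thesis using z(2) w1 Suc.prems(1) by auto
  next
    case (Suc q')
    then show ?thesis using z(3)[of q'] by simp
  qed
  moreover have "\<exists>a \<in> X (Suc p) (Suc q). \<exists>b \<in> X p (Suc (Suc q)). w = f p a + h (Suc q) b"
    if v: "\<exists>v \<in> X (Suc p + q) 1. z = h 0 v"
  proof -
    from z(4)[OF v] obtain a b where ab: "a \<in> X (Suc (Suc p)) q" "b \<in> X (Suc p) (Suc q)"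
      "w1 = f (Suc p) a + h q b" by blast
    have "w1 - h q b = f (Suc p) a" using ab by simp
    then have "f p w1 - f p (h q b) = 0" using ff[OF ab(1)] f_diff by metis
    then have "h q (w - f p b) = 0" using w1(2) comm[OF ab(2)] h_diff by simp
    then obtain e where "e \<in> X p (Suc (Suc q))" "h (Suc q) e = w - f p b"
      using h_exact[of "w - f p b" p q] diff_in f_in Suc.prems(1) ab(2) by blast
    then show ?thesis using ab(2) by (metis add.commute diff_add_cancel)
  qed
  ultimately show ?case using z(1) by auto
qed

section \<open>Strands of a free module\<close>

text \<open>
The degree \<open>b\<close> part of a free module with basis degrees \<open>G c\<close> for \<open>c < N\<close>. The basis of this part
consists of the monomial multiples of the basis vectors, so a vector is recorded by its coefficients.
\<close>

definition strand :: "nat \<Rightarrow> (nat \<Rightarrow> 'n \<Rightarrow> nat) \<Rightarrow> ('n \<Rightarrow> nat) \<Rightarrow> (nat \<Rightarrow> 'k::field) set" where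
  "strand N G b = {f. \<forall>c. f c \<noteq> 0 \<longrightarrow> c < N \<and> G c \<le> b}"

section \<open>The Koszul complex\<close>

text \<open>
The signs need a linear order of the variables. A finite type carries none, hence the numbering by
\<open>to_nat\<close>.
\<close>

definition koszul_sign :: "'n::finite \<Rightarrow> 'n set \<Rightarrow> 'k::field" where
  "koszul_sign i E = (- 1) ^ card {j \<in> E. to_nat j < to_nat i}"

lemma koszul_sign_square: "koszul_sign i E * koszul_sign i E = (1::'k::field)"
  unfolding koszul_sign_def by (simp flip: power_mult_distrib)

lemma koszul_sign_swap:
  fixes i j :: "'n::finite"
  assumes "i \<noteq> j" "i \<notin> E" "j \<notin> E"
  shows "koszul_sign i E * koszul_sign j (insert i E)
       = - (koszul_sign j E * koszul_sign i (insert j E) :: 'k::field)"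
proof -
  have *: "koszul_sign i E * koszul_sign j (insert i E)
       = - (koszul_sign j E * koszul_sign i (insert j E) :: 'k)"
    if "to_nat i < to_nat j" "i \<notin> E" for i j :: 'n
  proof -
    have 1: "{l \<in> insert i E. to_nat l < to_nat j} = insert i {l \<in> E. to_nat l < to_nat j}"
      and 2: "{l \<in> insert j E. to_nat l < to_nat i} = {l \<in> E. to_nat l < to_nat i}"
      using that by auto
    show ?thesis unfolding koszul_sign_def 1 2 using that by simp
  qed
  from assms consider "to_nat i < to_nat j" | "to_nat j < to_nat i"
    by (metis inj_eq inj_to_nat linorder_neqE_nat)
  then show ?thesis using *[of i j] *[of j i] assms by cases auto
qed

text \<open>
The subset \<open>E\<close> stands for the wedge product of the basis vectors of the Koszul complex indexed by \<open>E\<close>.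
The differential removes one variable \<open>i\<close> at a time; the factor \<open>x\<^sub>i\<close> is invisible because multiplication
by a monomial does not change coefficient vectors.
\<close>

definition koszul :: "'n::finite set \<Rightarrow> ('n set \<Rightarrow> nat \<Rightarrow> 'k::field) \<Rightarrow> 'n set \<Rightarrow> nat \<Rightarrow> 'k" where
  "koszul A \<phi> E c = (\<Sum>i \<in> A - E. koszul_sign i E * \<phi> (insert i E) c)"

text \<open>
Pairs are cancelled by means of an order rather than by halving the sum, because the characteristic
may be 2.
\<close>

lemma sum_antisymmetric:
  fixes F :: "'n::finite \<Rightarrow> 'n \<Rightarrow> 'k::field"
  assumes anti: "\<And>i j. i \<in> B \<Longrightarrow> j \<in> B \<Longrightarrow> i \<noteq> j \<Longrightarrow> F i j = - F j i"
  shows "(\<Sum>i\<in>B. \<Sum>j\<in>B - {i}. F i j) = 0"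
proof -
  let ?L = "\<lambda>i j. to_nat i < to_nat (j::'n)"
  have eq: "i = j" if "\<not> ?L i j" "\<not> ?L j i" for i j :: 'n
    using that by (metis inj_eq inj_to_nat linorder_neqE_nat)
  have "(\<Sum>i\<in>B. \<Sum>j\<in>B - {i}. F i j)
      = (\<Sum>i\<in>B. \<Sum>j\<in>B. (if ?L i j then F i j else 0) + (if ?L j i then F i j else 0))"
  proof (rule sum.cong[OF refl])
    fix i assume "i \<in> B"
    have "(\<Sum>j\<in>B - {i}. F i j) = (\<Sum>j\<in>B. if j = i then 0 else F i j)"
      by (rule sum.mono_neutral_cong_left) auto
    also have "\<dots> = (\<Sum>j\<in>B. (if ?L i j then F i j else 0) + (if ?L j i then F i j else 0))"
      by (rule sum.cong) (use eq in auto)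
    finally show "(\<Sum>j\<in>B - {i}. F i j) = \<dots>" .
  qed
  also have "\<dots> = (\<Sum>i\<in>B. \<Sum>j\<in>B. if ?L i j then F i j else 0)
      + (\<Sum>i\<in>B. \<Sum>j\<in>B. if ?L j i then F i j else 0)"
    by (simp add: sum.distrib)
  also have "(\<Sum>i\<in>B. \<Sum>j\<in>B. if ?L j i then F i j else 0)
      = (\<Sum>i\<in>B. \<Sum>j\<in>B. if ?L i j then F j i else 0)"
    by (rule sum.swap)
  also have "\<dots> = (\<Sum>i\<in>B. \<Sum>j\<in>B. - (if ?L i j then F i j else 0))"
    by (intro sum.cong refl) (use anti in auto)
  finally show ?thesis by (simp add: sum_negf)
qed

lemma koszul_koszul: "koszul A (koszul A \<phi>) = (0 :: 'n::finite set \<Rightarrow> nat \<Rightarrow> 'k::field)"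
proof (intro ext)
  fix E :: "'n set" and c
  let ?F = "\<lambda>i j. koszul_sign i E * (koszul_sign j (insert i E) * \<phi> (insert j (insert i E)) c) :: 'k"
  have "koszul A (koszul A \<phi>) E c = (\<Sum>i\<in>A - E. \<Sum>j\<in>A - E - {i}. ?F i j)"
    unfolding koszul_def sum_distrib_left by (intro sum.cong) auto
  also have "\<dots> = 0"
  proof (rule sum_antisymmetric)
    fix i j assume "i \<in> A - E" "j \<in> A - E" "i \<noteq> j"
    then have "koszul_sign i E * koszul_sign j (insert i E)
       = - (koszul_sign j E * koszul_sign i (insert j E) :: 'k)"
      by (intro koszul_sign_swap) auto
    then show "?F i j = - ?F j i"
      by (simp only: mult.assoc[symmetric] insert_commute[of i j E] mult_minus_left)
  qed
  finally show "koszul A (koszul A \<phi>) E c = 0 E c" by simp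
qed

text \<open>
The degree \<open>\<gamma>\<close> part of the tensor product of a free module with the \<open>q\<close>-th term of the Koszul complex on
the variables in \<open>A\<close>. The basis vector indexed by \<open>E\<close> has degree \<open>1\<close> at the elements of \<open>E\<close> and \<open>0\<close>
elsewhere.
\<close>

definition koszul_strand ::
  "nat \<Rightarrow> (nat \<Rightarrow> 'n \<Rightarrow> nat) \<Rightarrow> 'n set \<Rightarrow> ('n \<Rightarrow> nat) \<Rightarrow> nat \<Rightarrow> ('n set \<Rightarrow> nat \<Rightarrow> 'k::field) set" where
  "koszul_strand N G A \<gamma> q = {\<phi>. \<forall>E c. \<phi> E c \<noteq> 0 \<longrightarrow>
     E \<subseteq> A \<and> card E = q \<and> c < N \<and> (\<forall>i. G c i + of_bool (i \<in> E) \<le> \<gamma> i)}"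

lemma koszul_strandD:
  assumes "\<phi> \<in> koszul_strand N G A \<gamma> q" "\<phi> E c \<noteq> 0"
  shows "E \<subseteq> A" "card E = q" "c < N" "G c i + of_bool (i \<in> E) \<le> \<gamma> i"
  using assms unfolding koszul_strand_def by blast+

lemma koszul_in_strand:
  fixes \<phi> :: "'n::finite set \<Rightarrow> nat \<Rightarrow> 'k::field"
  assumes "\<phi> \<in> koszul_strand N G A \<gamma> (Suc q)"
  shows "koszul A \<phi> \<in> koszul_strand N G A \<gamma> q"
  unfolding koszul_strand_def
proof (intro CollectI allI impI)
  fix E c assume "koszul A \<phi> E c \<noteq> 0"
  then obtain i where i: "i \<in> A - E" "\<phi> (insert i E) c \<noteq> 0"
    unfolding koszul_def by (metis (no_types, lifting) mult_zero_right sum.neutral)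
  have "G c j + of_bool (j \<in> E) \<le> \<gamma> j" for j
    using koszul_strandD(4)[OF assms i(2), of j] by (auto split: if_splits)
  then show "E \<subseteq> A \<and> card E = q \<and> c < N \<and> (\<forall>i. G c i + of_bool (i \<in> E) \<le> \<gamma> i)"
    using koszul_strandD[OF assms i(2)] i(1) by auto
qed

lemma koszul_zero_on_empty:
  fixes \<phi> :: "'n::finite set \<Rightarrow> nat \<Rightarrow> 'k::field"
  assumes "\<phi> \<in> koszul_strand N G A \<gamma> 0"
  shows "koszul A \<phi> = 0"
proof (intro ext)
  fix E c
  have "\<phi> (insert i E) c = 0" for i
    using koszul_strandD(2)[OF assms, of "insert i E" c] by auto
  then show "koszul A \<phi> E c = 0 E c" by (simp add: koszul_def)
qed

text \<open>
For a fixed basis element \<open>c\<close> the sets \<open>E\<close> that occur are the subsets of the set of \<open>t\<close> in \<open>A\<close> with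
\<open>G c t < \<gamma> t\<close>. If this set is nonempty, the complex is that of a full simplex, and adding a fixed vertex
\<open>t\<close> contracts it. If it is empty, only \<open>E = {}\<close> occurs and nothing contracts it; the last assumption
keeps \<open>\<phi>\<close> away from this case.
\<close>

lemma koszul_exact:
  fixes \<phi> :: "'n::finite set \<Rightarrow> nat \<Rightarrow> 'k::field"
  assumes \<phi>: "\<phi> \<in> koszul_strand N G A \<gamma> q" and cycle: "koszul A \<phi> = 0"
    and room: "\<And>c. q = 0 \<Longrightarrow> \<phi> {} c \<noteq> 0 \<Longrightarrow> \<exists>t \<in> A. G c t < \<gamma> t"
  shows "\<exists>\<psi> \<in> koszul_strand N G A \<gamma> (Suc q). koszul A \<psi> = \<phi>"
proof -
  \<comment> \<open>The vertices that can be added to a set occurring with the basis element \<open>c\<close>.\<close>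
  define free where "free c = {t \<in> A. G c t < \<gamma> t}" for c
  define t where "t c = (SOME t. t \<in> free c)" for c
  have t: "t c \<in> A" "G c (t c) < \<gamma> (t c)" if "free c \<noteq> {}" for c
    using that some_in_eq[of "free c"] unfolding t_def free_def by auto
  have free: "free c \<noteq> {}" if "\<phi> E c \<noteq> 0" for E c
  proof (cases "q = 0")
    case True
    then have "E = {}" using koszul_strandD(2)[OF \<phi> that] by simp
    then show ?thesis using room[OF True, of c] that unfolding free_def by auto
  next
    case False
    then have "E \<noteq> {}" using koszul_strandD(2)[OF \<phi> that] by auto
    then obtain i where "i \<in> E" by blast
    then show ?thesis using koszul_strandD(1)[OF \<phi> that] koszul_strandD(4)[OF \<phi> that, of i] unfolding free_def by auto
  qed
  define \<psi> where "\<psi> E c = (if free c \<noteq> {} \<and> t c \<in> E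
    then koszul_sign (t c) (E - {t c}) * \<phi> (E - {t c}) c else 0)" for E c
  have "\<psi> \<in> koszul_strand N G A \<gamma> (Suc q)"
    unfolding koszul_strand_def
  proof (intro CollectI allI impI)
    fix E c assume "\<psi> E c \<noteq> 0"
    then have *: "free c \<noteq> {}" "t c \<in> E" "\<phi> (E - {t c}) c \<noteq> 0"
      unfolding \<psi>_def by (auto split: if_splits)
    have "G c i + of_bool (i \<in> E) \<le> \<gamma> i" for i
      using koszul_strandD(4)[OF \<phi> *(3), of i] t[OF *(1)] by (cases "i = t c") auto
    moreover have "card E = Suc q"
      using koszul_strandD(2)[OF \<phi> *(3)] *(2) by (metis card_Suc_Diff1 finite)
    ultimately show "E \<subseteq> A \<and> card E = Suc q \<and> c < N \<and> (\<forall>i. G c i + of_bool (i \<in> E) \<le> \<gamma> i)"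
      using koszul_strandD(1,3)[OF \<phi> *(3)] t[OF *(1)] by auto
  qed
  moreover have "koszul A \<psi> E c = \<phi> E c" for E c
  proof (cases "free c = {}")
    case True
    then show ?thesis using free by (auto simp: koszul_def \<psi>_def)
  next
    case False
    note t = t[OF False]
    show ?thesis
    proof (cases "t c \<in> E")
      case False
      have "koszul A \<psi> E c = (\<Sum>i \<in> A - E. if i = t c then \<phi> E c else 0)"
        unfolding koszul_def
      proof (rule sum.cong[OF refl])
        fix i assume "i \<in> A - E"
        then show "koszul_sign i E * \<psi> (insert i E) c = (if i = t c then \<phi> E c else 0)"
          using False \<open>free c \<noteq> {}\<close> koszul_sign_square[of "t c" E]
          by (auto simp: \<psi>_def simp flip: mult.assoc)
      qed
      then show ?thesis using False t by simp
    next
      case True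
      define H where "H = E - {t c}"
      have E: "E = insert (t c) H" "t c \<notin> H" using True by (auto simp: H_def)
      have "koszul A \<psi> E c = (\<Sum>i \<in> A - E. - (koszul_sign (t c) H * (koszul_sign i H * \<phi> (insert i H) c)))"
        unfolding koszul_def
      proof (rule sum.cong[OF refl])
        fix i assume i: "i \<in> A - E"
        then have "insert i E - {t c} = insert i H" "i \<noteq> t c" "i \<notin> H" using E by auto
        moreover from this have "koszul_sign i E * koszul_sign (t c) (insert i H)
            = - (koszul_sign (t c) H * koszul_sign i H :: 'k)"
        proof -
          let ?s = "koszul_sign :: 'n \<Rightarrow> 'n set \<Rightarrow> 'k"
          have sw: "?s i H * ?s (t c) (insert i H) = - (?s (t c) H * ?s i E)"
            using koszul_sign_swap[of i "t c" H] \<open>i \<noteq> t c\<close> \<open>i \<notin> H\<close> E by simp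
          have "?s i E * ?s (t c) (insert i H)
              = (?s (t c) H * ?s (t c) H) * (?s i H * ?s i H) * (?s i E * ?s (t c) (insert i H))"
            by (simp only: koszul_sign_square mult_1)
          also have "\<dots> = (?s i H * ?s (t c) (insert i H)) * (?s (t c) H * ?s (t c) H) * ?s i H * ?s i E"
            by (simp only: mult_ac)
          also have "\<dots> = - ((?s (t c) H * ?s (t c) H) * ?s (t c) H * ?s i H * (?s i E * ?s i E))"
            unfolding sw by (simp only: mult_ac mult_minus_left mult_minus_right)
          also have "\<dots> = - (?s (t c) H * ?s i H)"
            by (simp only: koszul_sign_square mult_1 mult_1_right)
          finally show ?thesis .
        qed
        ultimately show "koszul_sign i E * \<psi> (insert i E) c
            = - (koszul_sign (t c) H * (koszul_sign i H * \<phi> (insert i H) c))"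
          using True \<open>free c \<noteq> {}\<close> by (simp add: \<psi>_def flip: mult.assoc)
      qed
      also have "\<dots> = - (koszul_sign (t c) H * (\<Sum>i \<in> A - E. koszul_sign i H * \<phi> (insert i H) c))"
        by (simp add: sum_negf sum_distrib_left)
      also have "(\<Sum>i \<in> A - E. koszul_sign i H * \<phi> (insert i H) c)
          = koszul A \<phi> H c - koszul_sign (t c) H * \<phi> E c"
      proof -
        have "A - H = insert (t c) (A - E)" using E t by auto
        then show ?thesis using E by (simp add: koszul_def)
      qed
      also have "koszul A \<phi> H c = 0" using cycle by simp
      finally show ?thesis by (simp add: koszul_sign_square flip: mult.assoc)
    qed
  qed
  ultimately show ?thesis by blast
qed

lemma koszul_exact_Suc:
  fixes \<phi> :: "'n::finite set \<Rightarrow> nat \<Rightarrow> 'k::field"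
  assumes "\<phi> \<in> koszul_strand N G A \<gamma> (Suc q)" "koszul A \<phi> = 0"
  shows "\<exists>\<psi> \<in> koszul_strand N G A \<gamma> (Suc (Suc q)). koszul A \<psi> = \<phi>"
  using koszul_exact[OF assms] by simp

lemma koszul_diff: "koszul A (\<phi> - \<psi>) = koszul A \<phi> - koszul A \<psi>"
  by (intro ext) (simp add: koszul_def right_diff_distrib sum_subtractf)

lemma koszul_strand_zero: "0 \<in> koszul_strand N G A \<gamma> q"
  by (simp add: koszul_strand_def)

lemma koszul_strand_diff:
  assumes "\<phi> \<in> koszul_strand N G A \<gamma> q" "\<psi> \<in> koszul_strand N G A \<gamma> q"
  shows "\<phi> - \<psi> \<in> koszul_strand N G A \<gamma> q"
  unfolding koszul_strand_def
proof (intro CollectI allI impI)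
  fix E c assume "(\<phi> - \<psi>) E c \<noteq> 0"
  then have "\<phi> E c \<noteq> 0 \<or> \<psi> E c \<noteq> 0" by auto
  then show "E \<subseteq> A \<and> card E = q \<and> c < N \<and> (\<forall>i. G c i + of_bool (i \<in> E) \<le> \<gamma> i)"
    using assms unfolding koszul_strand_def by fast
qed

text \<open>
The degree left for the free module next to the Koszul basis vector indexed by \<open>E\<close>. Natural number
subtraction is harmless: wherever some \<open>i\<close> in \<open>E\<close> has \<open>\<gamma> i = 0\<close>, the component at \<open>E\<close> vanishes.
\<close>

definition shift :: "('n \<Rightarrow> nat) \<Rightarrow> 'n set \<Rightarrow> 'n \<Rightarrow> nat" where
  "shift \<gamma> E = (\<lambda>i. \<gamma> i - of_bool (i \<in> E))"

lemma koszul_strand_component: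
  assumes "\<phi> \<in> koszul_strand N G A \<gamma> q"
  shows "\<phi> E \<in> strand N G (shift \<gamma> E)"
  unfolding strand_def
proof (intro CollectI allI impI conjI le_funI)
  fix c i assume nz: "\<phi> E c \<noteq> 0"
  show "c < N" using koszul_strandD(3)[OF assms nz] .
  show "G c i \<le> shift \<gamma> E i"
    using koszul_strandD(4)[OF assms nz, of i] by (simp add: shift_def)
qed

lemma koszul_strand_lift:
  fixes T :: "(nat \<Rightarrow> 'k::field) \<Rightarrow> nat \<Rightarrow> 'k" and \<phi> :: "'n::finite set \<Rightarrow> nat \<Rightarrow> 'k"
  assumes \<phi>: "\<phi> \<in> koszul_strand N G A \<gamma> q" and T0: "T 0 = 0"
    and lift: "\<And>E. E \<subseteq> A \<Longrightarrow> card E = q \<Longrightarrow> (\<And>i. i \<in> E \<Longrightarrow> 0 < \<gamma> i) \<Longrightarrow>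
      \<exists>h \<in> strand N' G' (shift \<gamma> E). T h = \<phi> E"
  shows "\<exists>\<psi> \<in> koszul_strand N' G' A \<gamma> q. (\<lambda>E. T (\<psi> E)) = \<phi>"
proof -
  define ok where "ok E \<longleftrightarrow> E \<subseteq> A \<and> card E = q \<and> (\<forall>i \<in> E. 0 < \<gamma> i)" for E
  have zero: "\<phi> E = 0" if "\<not> ok E" for E
  proof (rule ext, rule ccontr)
    fix c assume "\<phi> E c \<noteq> 0 c"
    then have *: "\<phi> E c \<noteq> 0" by simp
    have "0 < \<gamma> i" if "i \<in> E" for i
      using koszul_strandD(4)[OF \<phi> *, of i] that by simp
    then show False using koszul_strandD(1,2)[OF \<phi> *] \<open>\<not> ok E\<close> unfolding ok_def by blast
  qed
  have "\<exists>h. (ok E \<longrightarrow> h \<in> strand N' G' (shift \<gamma> E)) \<and> (\<not> ok E \<longrightarrow> h = 0) \<and> T h = \<phi> E" for E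
  proof (cases "ok E")
    case True
    then show ?thesis using lift[of E] unfolding ok_def by blast
  qed (use zero T0 in auto)
  then obtain \<psi> where \<psi>: "\<And>E. ok E \<Longrightarrow> \<psi> E \<in> strand N' G' (shift \<gamma> E)"
      "\<And>E. \<not> ok E \<Longrightarrow> \<psi> E = 0" "\<And>E. T (\<psi> E) = \<phi> E"
    by metis
  have "\<psi> \<in> koszul_strand N' G' A \<gamma> q"
    unfolding koszul_strand_def
  proof (intro CollectI allI impI)
    fix E c assume nz: "\<psi> E c \<noteq> 0"
    then have ok: "ok E" using \<psi>(2)[of E] by fastforce
    then have "c < N'" and le: "G' c \<le> shift \<gamma> E"
      using \<psi>(1)[OF ok] nz unfolding strand_def by auto
    moreover have "G' c i + of_bool (i \<in> E) \<le> \<gamma> i" for i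
      using le_funD[OF le, of i] ok unfolding shift_def ok_def by force
    ultimately show "E \<subseteq> A \<and> card E = q \<and> c < N' \<and> (\<forall>i. G' c i + of_bool (i \<in> E) \<le> \<gamma> i)"
      using ok unfolding ok_def by blast
  qed
  then show ?thesis using \<psi>(3) by blast
qed

section \<open>Minimal resolutions as scalar matrices, and the lower bound\<close>

text \<open>
A minimal multigraded free resolution of \<open>S/M\<close>, strand by strand: \<open>\<beta> p\<close> is the rank in homological
degree \<open>p\<close>, \<open>G p c\<close> the degree of a basis element, \<open>D p\<close> the scalar matrix of the differential from
degree \<open>p + 1\<close> to degree \<open>p\<close>, and \<open>U\<close> the coefficients of the augmentation. Minimality is the strict
inequality of degrees: a nonzero entry of \<open>D p\<close> belongs to a monomial other than \<open>1\<close>. The degree \<open>b\<close> part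
of \<open>S/M\<close> is zero for \<open>b \<in> I\<close> and one-dimensional otherwise.
\<close>

locale scalar_resolution =
  fixes I :: "('n::finite \<Rightarrow> nat) set" and \<beta> :: "nat \<Rightarrow> nat" and G :: "nat \<Rightarrow> nat \<Rightarrow> 'n \<Rightarrow> nat"
    and D :: "nat \<Rightarrow> nat \<Rightarrow> nat \<Rightarrow> 'k::field" and U :: "nat \<Rightarrow> 'k"
  assumes upward: "b \<in> I \<Longrightarrow> b \<le> b' \<Longrightarrow> b' \<in> I"
    and minimal: "D p r c \<noteq> 0 \<Longrightarrow> r < \<beta> p \<and> G p r < G (Suc p) c"
    and augmentation_onto: "b \<notin> I \<Longrightarrow> \<exists>f \<in> strand (\<beta> 0) (G 0) b. (\<Sum>c<\<beta> 0. U c * f c) \<noteq> 0"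
    and exact_0: "f \<in> strand (\<beta> 0) (G 0) b \<Longrightarrow>
      (\<exists>h \<in> strand (\<beta> 1) (G 1) b. (\<lambda>r. \<Sum>c<\<beta> 1. D 0 r c * h c) = f) \<longleftrightarrow>
      b \<in> I \<or> (\<Sum>c<\<beta> 0. U c * f c) = 0"
    and exact_Suc: "f \<in> strand (\<beta> (Suc p)) (G (Suc p)) b \<Longrightarrow>
      (\<exists>h \<in> strand (\<beta> (Suc (Suc p))) (G (Suc (Suc p))) b.
         (\<lambda>r. \<Sum>c<\<beta> (Suc (Suc p)). D (Suc p) r c * h c) = f) \<longleftrightarrow>
      (\<lambda>r. \<Sum>c<\<beta> (Suc p). D p r c * f c) = 0"
begin

definition diff :: "nat \<Rightarrow> (nat \<Rightarrow> 'k) \<Rightarrow> nat \<Rightarrow> 'k" where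
  "diff p f = (\<lambda>r. \<Sum>c<\<beta> (Suc p). D p r c * f c)"

definition aug :: "(nat \<Rightarrow> 'k) \<Rightarrow> 'k" where
  "aug f = (\<Sum>c<\<beta> 0. U c * f c)"

lemma diff_exact_0:
  "f \<in> strand (\<beta> 0) (G 0) b \<Longrightarrow>
    (\<exists>h \<in> strand (\<beta> 1) (G 1) b. diff 0 h = f) \<longleftrightarrow> b \<in> I \<or> aug f = 0"
  using exact_0 unfolding diff_def aug_def by simp

lemma diff_exact_Suc:
  "f \<in> strand (\<beta> (Suc p)) (G (Suc p)) b \<Longrightarrow>
    (\<exists>h \<in> strand (\<beta> (Suc (Suc p))) (G (Suc (Suc p))) b. diff (Suc p) h = f) \<longleftrightarrow> diff p f = 0"
  using exact_Suc unfolding diff_def by blast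

lemma diff_nonzero:
  assumes "diff p f r \<noteq> 0"
  obtains c where "f c \<noteq> 0" "r < \<beta> p" "G p r < G (Suc p) c"
  using assms minimal unfolding diff_def
  by (metis (no_types, lifting) mult_zero_left mult_zero_right sum.neutral)

lemma diff_in_strand:
  assumes "f \<in> strand (\<beta> (Suc p)) (G (Suc p)) b"
  shows "diff p f \<in> strand (\<beta> p) (G p) b"
  unfolding strand_def
proof (intro CollectI allI impI)
  fix r assume "diff p f r \<noteq> 0"
  then obtain c where "f c \<noteq> 0" "r < \<beta> p" "G p r < G (Suc p) c" by (rule diff_nonzero)
  moreover from this have "G (Suc p) c \<le> b" using assms unfolding strand_def by blast
  ultimately show "r < \<beta> p \<and> G p r \<le> b" by auto
qed

lemma diff_minus: "diff p (f - g) = diff p f - diff p g"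
  by (intro ext) (simp add: diff_def right_diff_distrib sum_subtractf)

lemma diff_zero: "diff p 0 = 0"
  by (intro ext) (simp add: diff_def)

definition kdiff :: "nat \<Rightarrow> ('n set \<Rightarrow> nat \<Rightarrow> 'k) \<Rightarrow> 'n set \<Rightarrow> nat \<Rightarrow> 'k" where
  "kdiff p \<phi> = (\<lambda>E. diff p (\<phi> E))"

abbreviation double_strand :: "'n set \<Rightarrow> ('n \<Rightarrow> nat) \<Rightarrow> nat \<Rightarrow> nat \<Rightarrow> ('n set \<Rightarrow> nat \<Rightarrow> 'k) set" where
  "double_strand A \<gamma> p q \<equiv> koszul_strand (\<beta> p) (G p) A \<gamma> q"

lemma kdiff_minus: "kdiff p (\<phi> - \<psi>) = kdiff p \<phi> - kdiff p \<psi>"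
  by (intro ext) (simp add: kdiff_def diff_minus)

lemma kdiff_in_strand:
  assumes \<phi>: "\<phi> \<in> double_strand A \<gamma> (Suc p) q"
  shows "kdiff p \<phi> \<in> double_strand A \<gamma> p q"
  unfolding koszul_strand_def
proof (intro CollectI allI impI)
  fix E r assume "kdiff p \<phi> E r \<noteq> 0"
  then obtain c where c: "\<phi> E c \<noteq> 0" "r < \<beta> p" "G p r < G (Suc p) c"
    unfolding kdiff_def by (rule diff_nonzero)
  have "G p r i + of_bool (i \<in> E) \<le> \<gamma> i" for i
    using koszul_strandD(4)[OF \<phi> c(1), of i] le_funD[OF less_imp_le[OF c(3)], of i] by linarith
  then show "E \<subseteq> A \<and> card E = q \<and> r < \<beta> p \<and> (\<forall>i. G p r i + of_bool (i \<in> E) \<le> \<gamma> i)"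
    using koszul_strandD[OF \<phi> c(1)] c(2) by blast
qed

lemma kdiff_koszul: "kdiff p (koszul A \<phi>) = koszul A (kdiff p \<phi>)"
proof (intro ext)
  fix E r
  have "kdiff p (koszul A \<phi>) E r
      = (\<Sum>c<\<beta> (Suc p). \<Sum>i\<in>A - E. koszul_sign i E * (D p r c * \<phi> (insert i E) c))"
    by (simp add: kdiff_def diff_def koszul_def sum_distrib_left mult.left_commute)
  also have "\<dots> = koszul A (kdiff p \<phi>) E r"
    by (subst sum.swap) (simp add: kdiff_def diff_def koszul_def sum_distrib_left)
  finally show "kdiff p (koszul A \<phi>) E r = koszul A (kdiff p \<phi>) E r" .
qed

lemma kdiff_exact_Suc:
  assumes \<phi>: "\<phi> \<in> double_strand A \<gamma> (Suc p) q" and cycle: "kdiff p \<phi> = 0"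
  shows "\<exists>\<psi> \<in> double_strand A \<gamma> (Suc (Suc p)) q. kdiff (Suc p) \<psi> = \<phi>"
  unfolding kdiff_def
proof (rule koszul_strand_lift[OF \<phi>], rule diff_zero)
  fix E
  have "diff p (\<phi> E) = 0" using fun_cong[OF cycle, of E] by (simp add: kdiff_def)
  then show "\<exists>h \<in> strand (\<beta> (Suc (Suc p))) (G (Suc (Suc p))) (shift \<gamma> E). diff (Suc p) h = \<phi> E"
    using diff_exact_Suc koszul_strand_component[OF \<phi>] by blast
qed

lemma kdiff_exact_0:
  assumes \<phi>: "\<phi> \<in> double_strand A \<gamma> 0 q"
    and zero: "\<And>E. E \<subseteq> A \<Longrightarrow> card E = q \<Longrightarrow> (\<And>i. i \<in> E \<Longrightarrow> 0 < \<gamma> i) \<Longrightarrow>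
      shift \<gamma> E \<in> I \<or> aug (\<phi> E) = 0"
  shows "\<exists>\<psi> \<in> double_strand A \<gamma> 1 q. kdiff 0 \<psi> = \<phi>"
  unfolding kdiff_def
proof (rule koszul_strand_lift[OF \<phi>], rule diff_zero)
  fix E assume "E \<subseteq> A" "card E = q" "\<And>i. i \<in> E \<Longrightarrow> 0 < \<gamma> i"
  then have "shift \<gamma> E \<in> I \<or> aug (\<phi> E) = 0" by (rule zero)
  then show "\<exists>h \<in> strand (\<beta> 1) (G 1) (shift \<gamma> E). diff 0 h = \<phi> E"
    using diff_exact_0[OF koszul_strand_component[OF \<phi>]] by blast
qed

lemma kdiff_kdiff:
  assumes "\<phi> \<in> double_strand A \<gamma> (Suc (Suc p)) q"
  shows "kdiff p (kdiff (Suc p) \<phi>) = 0"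
proof
  fix E
  have "\<phi> E \<in> strand (\<beta> (Suc (Suc p))) (G (Suc (Suc p))) (shift \<gamma> E)"
    by (rule koszul_strand_component[OF assms])
  then show "kdiff p (kdiff (Suc p) \<phi>) E = 0 E"
    using diff_exact_Suc diff_in_strand unfolding kdiff_def by fastforce
qed

text \<open>
The zigzag with \<open>f\<close> the Koszul differential and \<open>h\<close> that of the resolution leads from the basis element
in homological degree \<open>n\<close>, placed at \<open>E = {}\<close>, to an element \<open>z\<close> of \<open>F\<^sub>0\<close> placed at \<open>E = UNIV\<close>. If \<open>z\<close> were
zero in \<open>S/M\<close>, the basis element would be a combination of proper multiples of basis elements and of
boundaries, which minimality forbids. The last step of the zigzag says that the variables kill the
class of \<open>z\<close>.
\<close>

lemma socle_exponent:
  assumes "0 < \<beta> CARD('n)"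
  shows "\<exists>\<mu>. \<mu> \<notin> I \<and> (\<forall>i. \<mu>(i := Suc (\<mu> i)) \<in> I)"
proof -
  let ?n = "CARD('n)"
  define \<alpha> where "\<alpha> = G ?n 0"
  define \<delta> :: "'n set \<Rightarrow> nat \<Rightarrow> 'k" where "\<delta> E c = of_bool (E = {} \<and> c = 0)" for E c
  let ?X = "\<lambda>p q. double_strand UNIV \<alpha> q p"
  have \<delta>: "\<delta> \<in> ?X 0 ?n"
    using assms by (auto simp: koszul_strand_def \<delta>_def \<alpha>_def)
  have start: "\<exists>y \<in> ?X (Suc 0) q'. koszul UNIV y = kdiff q' \<delta>" if "?n = Suc q'" for q'
  proof (rule koszul_exact)
    show *: "kdiff q' \<delta> \<in> ?X 0 q'" using kdiff_in_strand \<delta> that by simp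
    then show "koszul UNIV (kdiff q' \<delta>) = 0" by (rule koszul_zero_on_empty)
    fix c assume "kdiff q' \<delta> {} c \<noteq> 0"
    then obtain e where "\<delta> {} e \<noteq> 0" "G q' c < G (Suc q') e"
      unfolding kdiff_def by (rule diff_nonzero)
    then have "G q' c < \<alpha>" by (simp add: \<delta>_def \<alpha>_def that)
    then show "\<exists>t \<in> UNIV. G q' c t < \<alpha> t"
      by (meson UNIV_I leD le_funI linorder_not_le)
  qed
  have "\<exists>z \<in> ?X (0 + ?n) 0. (?n = 0 \<longrightarrow> z = \<delta>) \<and>
      (\<forall>q'. ?n = Suc q' \<longrightarrow> (\<exists>y \<in> ?X (0 + q') 1. koszul UNIV z = kdiff 0 y)) \<and>
      ((\<exists>v \<in> ?X (0 + ?n) 1. z = kdiff 0 v) \<longrightarrow>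
        (\<exists>a \<in> ?X (Suc 0) ?n. \<exists>b \<in> ?X 0 (Suc ?n). \<delta> = koszul UNIV a + kdiff ?n b))"
    by (rule zigzag[where X = ?X and f = "\<lambda>p. koszul UNIV" and h = kdiff])
      (rule koszul_diff kdiff_minus koszul_strand_zero koszul_koszul kdiff_koszul[symmetric] \<delta>
        | erule koszul_in_strand kdiff_in_strand kdiff_kdiff start
        | erule (1) koszul_strand_diff koszul_exact_Suc kdiff_exact_Suc)+
  then obtain z where z: "z \<in> ?X ?n 0"
    and link: "\<And>q'. ?n = Suc q' \<Longrightarrow> \<exists>y \<in> ?X q' 1. koszul UNIV z = kdiff 0 y"
    and backtrack: "(\<exists>v \<in> ?X ?n 1. z = kdiff 0 v) \<Longrightarrow>
        \<exists>a \<in> ?X (Suc 0) ?n. \<exists>b \<in> ?X 0 (Suc ?n). \<delta> = koszul UNIV a + kdiff ?n b"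
    by auto
  have "\<not> (\<exists>v \<in> ?X ?n 1. z = kdiff 0 v)"
  proof
    assume "\<exists>v \<in> ?X ?n 1. z = kdiff 0 v"
    from backtrack[OF this] obtain a b where a: "a \<in> ?X (Suc 0) ?n" and b: "b \<in> ?X 0 (Suc ?n)"
      and \<delta>_eq: "\<delta> = koszul UNIV a + kdiff ?n b" by blast
    \<comment> \<open>Neither summand has a component along the basis element: a multiple by a variable has no room in
      degree \<open>\<alpha>\<close>, and boundaries only involve basis elements of strictly smaller degree.\<close>
    have "a {i} 0 = 0" for i
      using koszul_strandD(4)[OF a, of "{i}" 0 i] by (auto simp: \<alpha>_def)
    then have "koszul UNIV a {} 0 = 0" by (simp add: koszul_def)
    moreover have "kdiff ?n b {} 0 = 0"
    proof (rule ccontr)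
      assume "kdiff ?n b {} 0 \<noteq> 0"
      then obtain c where c: "b {} c \<noteq> 0" "G ?n 0 < G (Suc ?n) c"
        unfolding kdiff_def by (rule diff_nonzero)
      have "G (Suc ?n) c \<le> \<alpha>" using koszul_strandD(4)[OF b c(1)] by (simp add: le_fun_def)
      then show False using c(2) by (simp add: \<alpha>_def)
    qed
    moreover have "\<delta> {} 0 = 1" by (simp add: \<delta>_def)
    ultimately show False using \<delta>_eq by simp
  qed
  then obtain E where "card E = ?n" and pos: "\<And>i. i \<in> E \<Longrightarrow> 0 < \<alpha> i"
    and nz: "shift \<alpha> E \<notin> I" "aug (z E) \<noteq> 0"
    using kdiff_exact_0[OF z] by metis
  then have E: "E = UNIV" by (metis card_subset_eq finite top_greatest)
  define \<mu> where "\<mu> = shift \<alpha> UNIV"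
  have \<alpha>: "\<alpha> i = Suc (\<mu> i)" for i using pos[of i] by (simp add: E \<mu>_def shift_def)
  have "\<mu>(i := Suc (\<mu> i)) \<in> I" for i
  proof -
    obtain q' where "?n = Suc q'" using zero_less_card_finite gr0_implies_Suc by blast
    then obtain y where y: "y \<in> ?X q' 1" "koszul UNIV z = kdiff 0 y" using link by blast
    let ?E = "UNIV - {i}"
    have sh: "shift \<alpha> ?E = \<mu>(i := Suc (\<mu> i))" by (auto simp: shift_def \<alpha>)
    have ins: "insert i ?E = UNIV" "UNIV - ?E = {i}" by auto
    have kz: "koszul UNIV z ?E = (\<lambda>c. koszul_sign i ?E * z UNIV c)"
      by (rule ext, simp only: koszul_def ins) (simp add: ins)
    have "y ?E \<in> strand (\<beta> 1) (G 1) (shift \<alpha> ?E)" by (rule koszul_strand_component[OF y(1)])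
    moreover from this have "diff 0 (y ?E) \<in> strand (\<beta> 0) (G 0) (shift \<alpha> ?E)"
      using diff_in_strand by simp
    ultimately have "shift \<alpha> ?E \<in> I \<or> aug (diff 0 (y ?E)) = 0"
      using diff_exact_0 by blast
    moreover have "diff 0 (y ?E) = (\<lambda>c. koszul_sign i ?E * z UNIV c)"
      using y(2) kz by (simp add: kdiff_def)
    then have "aug (diff 0 (y ?E)) = koszul_sign i ?E * aug (z UNIV)"
      by (simp add: aug_def sum_distrib_left mult.left_commute)
    then have "aug (diff 0 (y ?E)) \<noteq> 0"
      using nz(2) koszul_sign_square[of i ?E, where 'k='k] by (auto simp: E)
    ultimately show ?thesis by (simp add: sh)
  qed
  moreover have "\<mu> \<notin> I" using nz(1) by (simp add: \<mu>_def E)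
  ultimately show ?thesis by blast
qed

text \<open>
Now \<open>f\<close> is the differential of the resolution, and the zigzag starts at a lift of \<open>x\<^sup>\<mu>\<close> to \<open>F\<^sub>0\<close>, placed at
\<open>E = A\<close>. The first step is possible because every \<open>x\<^sub>i x\<^sup>\<mu>\<close> is zero in \<open>S/M\<close>. In degree \<open>\<gamma>\<close> a basis element
has no room for any variable of \<open>A\<close> exactly when its degree lies in the box. Without such a basis
element the Koszul direction is exact even at \<open>E = {}\<close>, so the zigzag can be undone and shows that the
lift of \<open>x\<^sup>\<mu>\<close> is a boundary.
\<close>

lemma basis_element_in_box:
  assumes \<mu>: "\<mu> \<notin> I" and socle: "\<And>i. \<mu>(i := Suc (\<mu> i)) \<in> I"
  shows "\<exists>p. \<exists>c < \<beta> p. \<forall>i. if i \<in> A then G p c i = Suc (\<mu> i) else G p c i \<le> \<mu> i"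
proof -
  define \<gamma> where "\<gamma> i = (if i \<in> A then Suc (\<mu> i) else \<mu> i)" for i
  have "\<exists>c < \<beta> (card A). G (card A) c \<le> \<gamma> \<and> (\<forall>i \<in> A. \<gamma> i \<le> G (card A) c i)"
  proof (rule ccontr)
    assume none: "\<not> ?thesis"
    obtain f where f: "f \<in> strand (\<beta> 0) (G 0) \<mu>" "aug f \<noteq> 0"
      using augmentation_onto[OF \<mu>] unfolding aug_def by blast
    define w where "w E = (if E = A then f else 0)" for E
    have sh: "shift \<gamma> A = \<mu>" by (auto simp: shift_def \<gamma>_def)
    have w: "w \<in> double_strand A \<gamma> 0 (card A)"
      unfolding koszul_strand_def
    proof (intro CollectI allI impI)
      fix E c assume "w E c \<noteq> 0"
      then have *: "E = A" "f c \<noteq> 0" by (auto simp: w_def split: if_splits)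
      then have "c < \<beta> 0" "G 0 c \<le> \<mu>" using f(1) unfolding strand_def by auto
      then show "E \<subseteq> A \<and> card E = card A \<and> c < \<beta> 0 \<and> (\<forall>i. G 0 c i + of_bool (i \<in> E) \<le> \<gamma> i)"
        using * by (auto simp: \<gamma>_def le_fun_def)
    qed
    have start: "\<exists>y \<in> double_strand A \<gamma> 1 q'. kdiff 0 y = koszul A w" if q': "card A = Suc q'" for q'
    proof (rule kdiff_exact_0)
      show "koszul A w \<in> double_strand A \<gamma> 0 q'" using koszul_in_strand w q' by metis
      fix E assume "E \<subseteq> A" "card E = q'"
      then have "E \<noteq> A" using q' by auto
      then obtain i where i: "i \<in> A - E" using \<open>E \<subseteq> A\<close> by blast
      have "\<mu>(i := Suc (\<mu> i)) \<le> shift \<gamma> E" using i \<open>E \<subseteq> A\<close> by (auto simp: le_fun_def shift_def \<gamma>_def)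
      then show "shift \<gamma> E \<in> I \<or> aug (koszul A w E) = 0" using upward socle by blast
    qed
    have "\<exists>z \<in> double_strand A \<gamma> (0 + card A) 0. (card A = 0 \<longrightarrow> z = w) \<and>
        (\<forall>q'. card A = Suc q' \<longrightarrow> (\<exists>y \<in> double_strand A \<gamma> (0 + q') 1. kdiff (0 + q') z = koszul A y)) \<and>
        ((\<exists>v \<in> double_strand A \<gamma> (0 + card A) 1. z = koszul A v) \<longrightarrow>
          (\<exists>a \<in> double_strand A \<gamma> (Suc 0) (card A). \<exists>b \<in> double_strand A \<gamma> 0 (Suc (card A)). w = kdiff 0 a + koszul A b))"
      by (rule zigzag[where X = "double_strand A \<gamma>" and h = "\<lambda>q. koszul A" and f = kdiff])
        (rule koszul_diff kdiff_minus koszul_strand_zero koszul_koszul kdiff_koszul w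
          | erule koszul_in_strand kdiff_in_strand kdiff_kdiff start[unfolded One_nat_def]
          | erule (1) koszul_strand_diff koszul_exact_Suc kdiff_exact_Suc)+
    then obtain z where z: "z \<in> double_strand A \<gamma> (card A) 0"
      and backtrack: "(\<exists>v \<in> double_strand A \<gamma> (card A) 1. z = koszul A v) \<Longrightarrow>
          \<exists>a \<in> double_strand A \<gamma> (Suc 0) (card A). \<exists>b \<in> double_strand A \<gamma> 0 (Suc (card A)). w = kdiff 0 a + koszul A b"
      by auto
    have "\<exists>v \<in> double_strand A \<gamma> (card A) (Suc 0). koszul A v = z"
    proof (rule koszul_exact[OF z koszul_zero_on_empty[OF z]])
      fix c assume nz: "z {} c \<noteq> 0"
      have "c < \<beta> (card A)" "G (card A) c \<le> \<gamma>"
        using koszul_strandD(3,4)[OF z nz] by (auto simp: le_fun_def)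
      then show "\<exists>t \<in> A. G (card A) c t < \<gamma> t" using none by (meson linorder_not_le)
    qed
    then obtain a b where a: "a \<in> double_strand A \<gamma> (Suc 0) (card A)" and w_eq: "w = kdiff 0 a + koszul A b"
      using backtrack by fastforce
    \<comment> \<open>No variable is left to be removed from a set larger than \<open>A\<close>, so only the boundary remains.\<close>
    have "koszul A b A = 0" by (rule ext) (simp add: koszul_def)
    then have "f = diff 0 (a A)" using fun_cong[OF w_eq, of A] by (simp add: w_def kdiff_def)
    moreover have "a A \<in> strand (\<beta> 1) (G 1) \<mu>"
      using koszul_strand_component[OF a, of A] by (simp add: sh)
    ultimately show False using diff_exact_0[OF f(1)] f(2) \<mu> by blast
  qed
  then obtain c where c: "c < \<beta> (card A)" "G (card A) c \<le> \<gamma>" "\<forall>i \<in> A. \<gamma> i \<le> G (card A) c i" by blast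
  have "if i \<in> A then G (card A) c i = Suc (\<mu> i) else G (card A) c i \<le> \<mu> i" for i
    using le_funD[OF c(2), of i] c(3) by (auto simp: \<gamma>_def intro: antisym)
  then show ?thesis using c(1) by blast
qed

theorem sum_ranks_ge:
  assumes "0 < \<beta> CARD('n)" and vanish: "\<And>p. CARD('n) < p \<Longrightarrow> \<beta> p = 0"
  shows "2 ^ CARD('n) \<le> (\<Sum>p=0..CARD('n). \<beta> p)"
proof -
  obtain \<mu> where \<mu>: "\<mu> \<notin> I" "\<And>i. \<mu>(i := Suc (\<mu> i)) \<in> I"
    using socle_exponent[OF assms(1)] by blast
  define box where "box A e \<longleftrightarrow> (case e of (p, c) \<Rightarrow> c < \<beta> p \<and>
    (\<forall>i. if i \<in> A then G p c i = Suc (\<mu> i) else G p c i \<le> \<mu> i))" for A e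
  define e where "e A = (SOME e. box A e)" for A
  have e: "box A (e A)" for A
    using basis_element_in_box[OF \<mu>, of A] unfolding e_def box_def
    by (intro someI_ex[where P = "box A", unfolded box_def]) auto
  have "inj e"
  proof (rule injI)
    fix A B assume eq: "e A = e B"
    have "i \<in> A \<longleftrightarrow> i \<in> B" for i
      using e[of A] e[of B] unfolding eq box_def by (cases "e B") (force split: if_splits)
    then show "A = B" by blast
  qed
  moreover have "range e \<subseteq> (SIGMA p:{0..CARD('n)}. {..<\<beta> p})"
  proof
    fix x assume "x \<in> range e"
    then obtain A where "box A x" using e by blast
    then show "x \<in> (SIGMA p:{0..CARD('n)}. {..<\<beta> p})"
      using vanish unfolding box_def by (cases x) (force simp: not_less[symmetric])
  qed
  ultimately have "card (UNIV :: 'n set set) \<le> card (SIGMA p:{0..CARD('n)}. {..<\<beta> p})"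
    by (intro card_inj_on_le[of e]) auto
  then show ?thesis by (simp add: card_UNIV_set)
qed

end

section \<open>Dickson's lemma\<close>

text \<open>
A monotone subsequence of natural numbers is increasing or else decreasing, and then it is constant
from the place of its minimum on.
\<close>

lemma incseq_subseq_nat:
  fixes g :: "nat \<Rightarrow> nat"
  shows "\<exists>r. strict_mono r \<and> incseq (\<lambda>k. g (r k))"
proof -
  obtain s :: "nat \<Rightarrow> nat" where s: "strict_mono s" "monoseq (\<lambda>k. g (s k))"
    using seq_monosub by blast
  from s(2) consider "incseq (\<lambda>k. g (s k))" | "decseq (\<lambda>k. g (s k))"
    unfolding monoseq_iff by blast
  then show ?thesis
  proof cases
    case 1
    then show ?thesis using s(1) by blast
  next
    case 2
    obtain l where l: "\<And>k. g (s l) \<le> g (s k)"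
      using ex_has_least_nat[of "\<lambda>_. True" _ "\<lambda>k. g (s k)"] by blast
    have "g (s (l + k)) = g (s l)" for k
      using l decseqD[OF 2, of l "l + k"] by (simp add: antisym)
    moreover have "strict_mono (\<lambda>k. s (l + k))"
      using s(1) by (simp add: strict_mono_def)
    ultimately show ?thesis by (intro exI[of _ "\<lambda>k. s (l + k)"]) (simp add: incseq_def)
  qed
qed

lemma incseq_subseq_fun:
  fixes f :: "nat \<Rightarrow> 'n::finite \<Rightarrow> nat"
  shows "\<exists>r. strict_mono r \<and> incseq (\<lambda>k. f (r k))"
proof -
  have "finite F \<Longrightarrow> \<exists>r. strict_mono r \<and> (\<forall>i \<in> F. incseq (\<lambda>k. f (r k) i))" for F :: "'n set"
  proof (induction F rule: finite_induct)
    case empty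
    then show ?case using strict_mono_id by blast
  next
    case (insert i F)
    then obtain r where r: "strict_mono r" "\<forall>i \<in> F. incseq (\<lambda>k. f (r k) i)" by blast
    obtain s where s: "strict_mono s" "incseq (\<lambda>k. f (r (s k)) i)"
      using incseq_subseq_nat[of "\<lambda>k. f (r k) i"] by blast
    have "incseq (\<lambda>k. f (r (s k)) j)" if "j \<in> F" for j
      using r(2) s(1) that by (simp add: incseq_def strict_mono_leD)
    then show ?case using strict_mono_compose[OF r(1) s(1)] s(2) by (metis insert_iff)
  qed
  from this[of UNIV] show ?thesis by (auto simp: incseq_def le_fun_def)
qed

text \<open>
The minimal elements do the job. Infinitely many of them would give an injective sequence, which has
an increasing subsequence, contradicting that distinct minimal elements are incomparable.
\<close>

lemma dickson:
  fixes S :: "('n::finite \<Rightarrow> nat) set"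
  shows "\<exists>J. finite J \<and> J \<subseteq> S \<and> (\<forall>b \<in> S. \<exists>j \<in> J. j \<le> b)"
proof -
  define J where "J = {j \<in> S. \<forall>x \<in> S. x \<le> j \<longrightarrow> x = j}"
  have "finite J"
  proof (rule ccontr)
    assume "infinite J"
    then obtain f :: "nat \<Rightarrow> 'n \<Rightarrow> nat" where f: "inj f" "range f \<subseteq> J"
      using infinite_countable_subset by blast
    obtain r where r: "strict_mono r" "incseq (\<lambda>k. f (r k))" using incseq_subseq_fun by blast
    have "f (r 0) \<le> f (r 1)" using r(2) by (simp add: incseq_def)
    moreover have "f (r 0) \<in> J" "f (r 1) \<in> J" using f(2) by auto
    ultimately have "f (r 0) = f (r 1)" unfolding J_def by blast
    then have "r 0 = r 1" using f(1) by (simp add: inj_eq)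
    then show False using strict_monoD[OF r(1), of 0 1] by simp
  qed
  moreover have "\<exists>j \<in> J. j \<le> b" if b: "b \<in> S" for b
  proof -
    obtain j where j: "j \<in> S" "j \<le> b" and least: "\<And>x. x \<in> S \<Longrightarrow> x \<le> b \<Longrightarrow> sum j UNIV \<le> sum x UNIV"
      using ex_has_least_nat[of "\<lambda>x. x \<in> S \<and> x \<le> b" b "\<lambda>x. sum x UNIV"] b by auto
    have "x = j" if x: "x \<in> S" "x \<le> j" for x
    proof (rule ccontr)
      assume "x \<noteq> j"
      then obtain i where "x i \<noteq> j i" by blast
      then have "x i < j i" using le_funD[OF x(2), of i] by simp
      then have "sum x UNIV < sum j UNIV"
        using x(2) by (intro sum_strict_mono_ex1) (auto simp: le_fun_def)
      then show False using least[of x] x j by (meson leD order_trans)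
    qed
    then show ?thesis using j unfolding J_def by blast
  qed
  ultimately show ?thesis unfolding J_def by blast
qed

section \<open>Existence of a minimal resolution\<close>

definition lin_closed :: "(nat \<Rightarrow> 'k::field) set \<Rightarrow> bool" where
  "lin_closed W \<longleftrightarrow> 0 \<in> W \<and> (\<forall>x \<in> W. \<forall>y \<in> W. \<forall>s. (\<lambda>i. x i + s * y i) \<in> W)"

lemma lin_closedD:
  assumes "lin_closed W"
  shows "0 \<in> W" "x \<in> W \<Longrightarrow> y \<in> W \<Longrightarrow> (\<lambda>i. x i + s * y i) \<in> W"
  using assms unfolding lin_closed_def by blast+

lemma lin_closed_sum:
  assumes "lin_closed W" "finite P" "\<And>p. p \<in> P \<Longrightarrow> a p \<noteq> 0 \<Longrightarrow> w p \<in> W"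
  shows "(\<lambda>i. \<Sum>p\<in>P. a p * w p i) \<in> W"
  using assms(2,3)
proof (induction P rule: finite_induct)
  case empty
  then show ?case using lin_closedD(1)[OF assms(1)] by (simp add: zero_fun_def)
next
  case (insert p P)
  then have IH: "(\<lambda>i. \<Sum>p\<in>P. a p * w p i) \<in> W" by blast
  show ?case
  proof (cases "a p = 0")
    case True
    then show ?thesis using IH insert by simp
  next
    case False
    then have "w p \<in> W" using insert by blast
    from lin_closedD(2)[OF assms(1) IH this, of "a p"] show ?thesis
      using insert by (simp add: add.commute)
  qed
qed

text \<open>
Induction on the number of coordinates: one vector takes care of the last coordinate, and subtracting
multiples of it reduces to the vectors whose last coordinate is zero.
\<close>

lemma finite_spanning_set:
  fixes W :: "(nat \<Rightarrow> 'k::field) set"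
  assumes "lin_closed W" "\<And>f c. f \<in> W \<Longrightarrow> f c \<noteq> 0 \<Longrightarrow> c < N"
  shows "\<exists>B. finite B \<and> B \<subseteq> W \<and> (\<forall>f \<in> W. \<exists>a. f = (\<lambda>x. \<Sum>w\<in>B. a w * w x))"
  using assms
proof (induction N arbitrary: W)
  case 0
  then have "f = (\<lambda>x. 0)" if "f \<in> W" for f using that by blast
  then show ?case by (intro exI[of _ "{}"]) auto
next
  case (Suc N)
  define W' where "W' = {f \<in> W. f N = 0}"
  have lin': "lin_closed W'"
    using lin_closedD[OF Suc.prems(1)] unfolding lin_closed_def W'_def by auto
  have "c < N" if "f \<in> W'" "f c \<noteq> 0" for f c
    using Suc.prems(2)[of f c] that unfolding W'_def by (cases "c = N") auto
  from Suc.IH[OF lin' this] obtain B where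
    B': "finite B \<and> B \<subseteq> W' \<and> (\<forall>f \<in> W'. \<exists>a. f = (\<lambda>x. \<Sum>w\<in>B. a w * w x))" ..
  note B = B'[THEN conjunct1] B'[THEN conjunct2, THEN conjunct1]
    B'[THEN conjunct2, THEN conjunct2, rule_format]
  show ?case
  proof (cases "W \<subseteq> W'")
    case True
    then show ?thesis using B unfolding W'_def by blast
  next
    case False
    then obtain v where v: "v \<in> W" "v N \<noteq> 0" unfolding W'_def by blast
    then have "v \<notin> B" using B(2) unfolding W'_def by blast
    have "\<exists>a. f = (\<lambda>x. \<Sum>w\<in>insert v B. a w * w x)" if f: "f \<in> W" for f
    proof -
      let ?s = "f N / v N"
      have "(\<lambda>i. f i + (- ?s) * v i) \<in> W'"
        using lin_closedD(2)[OF Suc.prems(1) f v(1), of "- ?s"] v(2) unfolding W'_def by simp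
      from B(3)[OF this] obtain a where a: "(\<lambda>i. f i + (- ?s) * v i) = (\<lambda>x. \<Sum>w\<in>B. a w * w x)"
        by blast
      have "f x = (\<Sum>w\<in>insert v B. (a(v := ?s)) w * w x)" for x
      proof -
        have "(\<Sum>w\<in>B. (a(v := ?s)) w * w x) = (\<Sum>w\<in>B. a w * w x)"
          using \<open>v \<notin> B\<close> by (intro sum.cong) auto
        then show ?thesis using fun_cong[OF a, of x] B(1) \<open>v \<notin> B\<close> by (simp add: algebra_simps)
      qed
      then show ?thesis by blast
    qed
    then show ?thesis using B v unfolding W'_def by (intro exI[of _ "insert v B"]) auto
  qed
qed

text \<open>
The strands \<open>W b\<close> of a graded submodule of a free module with basis degrees \<open>G\<close>, seen as nested spaces
of coefficient vectors. Each strand occurs already at a degree of the finite set \<open>J\<close> below it, which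
makes the submodule finitely generated. The last condition says that the submodule lies in the maximal
ideal times the free module.
\<close>

definition syzygy_family ::
  "nat \<Rightarrow> (nat \<Rightarrow> 'n \<Rightarrow> nat) \<Rightarrow> (('n \<Rightarrow> nat) \<Rightarrow> (nat \<Rightarrow> 'k::field) set) \<Rightarrow> bool" where
  "syzygy_family N G W \<longleftrightarrow>
     (\<forall>b. lin_closed (W b) \<and> W b \<subseteq> strand N G b) \<and> mono W \<and>
     (\<exists>J. finite J \<and> (\<forall>b. \<exists>j \<in> J. j \<le> b \<and> W b \<subseteq> W j)) \<and>
     (\<forall>b. \<forall>f \<in> W b. \<forall>c. G c = b \<longrightarrow> f c = 0)"

text \<open>
A generator is paired with its degree because the spaces \<open>W b\<close> share their vectors, so that a vector
does not determine its degree.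
\<close>

definition generates ::
  "(('n \<Rightarrow> nat) \<times> (nat \<Rightarrow> 'k::field)) set \<Rightarrow> (('n \<Rightarrow> nat) \<Rightarrow> (nat \<Rightarrow> 'k) set) \<Rightarrow> bool" where
  "generates P W \<longleftrightarrow> finite P \<and> (\<forall>p \<in> P. snd p \<in> W (fst p)) \<and>
     (\<forall>b. \<forall>f \<in> W b. \<exists>a. (\<forall>p. a p \<noteq> 0 \<longrightarrow> p \<in> P \<and> fst p \<le> b) \<and> f = (\<lambda>r. \<Sum>p\<in>P. a p * snd p r))"

lemma generates_ex:
  assumes W: "syzygy_family N G W"
  shows "\<exists>P. generates P W"
proof -
  obtain J where J: "finite J" "\<And>b. \<exists>j \<in> J. j \<le> b \<and> W b \<subseteq> W j"
    using W unfolding syzygy_family_def by blast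
  have "\<exists>B. finite B \<and> B \<subseteq> W j \<and> (\<forall>f \<in> W j. \<exists>a. f = (\<lambda>x. \<Sum>w\<in>B. a w * w x))" for j
    by (rule finite_spanning_set[where N = N]) (use W in \<open>auto simp: syzygy_family_def strand_def\<close>)
  from choice[OF allI[OF this]] obtain B where
    B': "\<forall>j. finite (B j) \<and> B j \<subseteq> W j \<and> (\<forall>f \<in> W j. \<exists>a. f = (\<lambda>x. \<Sum>w\<in>B j. a w * w x))" ..
  note B = B'[THEN spec, THEN conjunct1] B'[THEN spec, THEN conjunct2, THEN conjunct1]
    B'[THEN spec, THEN conjunct2, THEN conjunct2, rule_format]
  have "generates (SIGMA j:J. B j) W"
    unfolding generates_def
  proof (intro conjI allI ballI)
    fix b f assume f: "f \<in> W b"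
    obtain j where j: "j \<in> J" "j \<le> b" "W b \<subseteq> W j" using J(2) by blast
    obtain a where a: "f = (\<lambda>x. \<Sum>w\<in>B j. a w * w x)" using B(3) j(3) f by blast
    let ?a = "\<lambda>(i, w). if i = j \<and> w \<in> B j then a w else 0"
    have "f = (\<lambda>r. \<Sum>p\<in>Sigma J B. ?a p * snd p r)"
    proof
      fix r
      have "(\<Sum>p\<in>Sigma J B. ?a p * snd p r) = (\<Sum>i\<in>J. \<Sum>w\<in>B i. ?a (i, w) * w r)"
        using J(1) B(1) by (subst sum.Sigma) (auto intro!: sum.cong)
      also have "\<dots> = (\<Sum>i\<in>J. if i = j then \<Sum>w\<in>B j. a w * w r else 0)"
        by (intro sum.cong) auto
      also have "\<dots> = f r" using J(1) j(1) a by simp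
      finally show "f r = (\<Sum>p\<in>Sigma J B. ?a p * snd p r)" by simp
    qed
    moreover have "\<forall>p. ?a p \<noteq> 0 \<longrightarrow> p \<in> Sigma J B \<and> fst p \<le> b"
      using j by auto
    ultimately show "\<exists>a. (\<forall>p. a p \<noteq> 0 \<longrightarrow> p \<in> Sigma J B \<and> fst p \<le> b)
        \<and> f = (\<lambda>r. \<Sum>p\<in>Sigma J B. a p * snd p r)" by blast
  qed (use J(1) B(1) subsetD[OF B(2)] in auto)
  then show ?thesis by blast
qed

text \<open>
Nakayama's lemma in elementary form: the relation has the degree of \<open>q\<close>, so it expresses \<open>q\<close> by
generators of degree at most that of \<open>q\<close>, and these are available wherever \<open>q\<close> is.
\<close>

lemma generates_remove:
  assumes P: "generates P W" and a: "\<And>p. a p \<noteq> 0 \<Longrightarrow> p \<in> P \<and> fst p \<le> fst q"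
    and relation: "\<And>r. (\<Sum>p\<in>P. a p * snd p r) = 0" and q: "a q \<noteq> 0"
  shows "generates (P - {q}) W"
  unfolding generates_def
proof (intro conjI allI ballI)
  fix b f assume "f \<in> W b"
  then obtain e where e: "\<And>p. e p \<noteq> 0 \<Longrightarrow> p \<in> P \<and> fst p \<le> b" "f = (\<lambda>r. \<Sum>p\<in>P. e p * snd p r)"
    using P unfolding generates_def by blast
  \<comment> \<open>The multiple of the relation that cancels the coefficient of \<open>q\<close>.\<close>
  define e' where "e' p = e p - e q / a q * a p" for p
  have e'q: "e' q = 0" using q by (simp add: e'_def)
  have "p \<in> P - {q} \<and> fst p \<le> b" if "e' p \<noteq> 0" for p
  proof -
    have "p \<noteq> q" using that e'q by auto
    moreover have "p \<in> P \<and> fst p \<le> b"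
    proof (cases "e p = 0")
      case True
      then have "e q \<noteq> 0" "a p \<noteq> 0" using that by (auto simp: e'_def)
      then show ?thesis using e(1)[of q] a[of p] by (meson order_trans)
    qed (use e(1) in blast)
    ultimately show ?thesis by blast
  qed
  moreover have "f = (\<lambda>r. \<Sum>p\<in>P - {q}. e' p * snd p r)"
  proof
    fix r
    have "(\<Sum>p\<in>P - {q}. e' p * snd p r) = (\<Sum>p\<in>P. e' p * snd p r)"
      using P e'q by (intro sum.mono_neutral_left) (auto simp: generates_def)
    also have "\<dots> = (\<Sum>p\<in>P. e p * snd p r) - e q / a q * (\<Sum>p\<in>P. a p * snd p r)"
      by (simp add: e'_def left_diff_distrib sum_subtractf sum_distrib_left mult.assoc)
    finally show "f r = (\<Sum>p\<in>P - {q}. e' p * snd p r)" using relation e(2) by simp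
  qed
  ultimately show "\<exists>a. (\<forall>p. a p \<noteq> 0 \<longrightarrow> p \<in> P - {q} \<and> fst p \<le> b)
      \<and> f = (\<lambda>r. \<Sum>p\<in>P - {q}. a p * snd p r)" by blast
qed (use P in \<open>auto simp: generates_def\<close>)

text \<open>
A generating set of smallest cardinality, listed by \<open>c < m\<close>. The last conclusion is minimality for the
next step of the resolution: by \<open>generates_remove\<close> no relation has a nonzero constant coefficient.
\<close>

lemma minimal_generators:
  fixes W :: "('n \<Rightarrow> nat) \<Rightarrow> (nat \<Rightarrow> 'k::field) set"
  assumes W: "syzygy_family N G W"
  shows "\<exists>m h w. (\<forall>c<m. w c \<in> W (h c)) \<and>
    (\<forall>b. \<forall>f \<in> W b. \<exists>a \<in> strand m h b. f = (\<lambda>r. \<Sum>c<m. w c r * a c)) \<and>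
    (\<forall>b. \<forall>a \<in> strand m h b. (\<lambda>r. \<Sum>c<m. w c r * a c) = 0 \<longrightarrow> (\<forall>c. h c = b \<longrightarrow> a c = 0))"
proof -
  obtain P where P: "generates P W" and least: "\<And>Q. generates Q W \<Longrightarrow> card P \<le> card Q"
    using ex_has_least_nat[of "\<lambda>P. generates P W" _ card] generates_ex[OF W] by blast
  have fin: "finite P" using P unfolding generates_def by blast
  obtain e where e: "bij_betw e {..<card P} P"
    using fin bij_betw_from_nat_into_finite by blast
  define i where "i = the_inv_into {..<card P} e"
  have ie: "i (e c) = c" if "c < card P" for c
    using e that unfolding i_def bij_betw_def by (simp add: the_inv_into_f_f)
  have eP: "e c \<in> P" if "c < card P" for c using e that by (auto dest: bij_betwE)
  have reindex: "(\<Sum>p\<in>P. g p) = (\<Sum>c<card P. g (e c))" for g :: "_ \<Rightarrow> 'k"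
    by (rule sum.reindex_bij_betw[OF e, symmetric])
  show ?thesis
  proof (intro exI conjI allI ballI impI)
    fix c assume "c < card P"
    then show "snd (e c) \<in> W (fst (e c))" using P eP unfolding generates_def by blast
  next
    fix b f assume "f \<in> W b"
    then obtain a where a: "\<And>p. a p \<noteq> 0 \<Longrightarrow> p \<in> P \<and> fst p \<le> b" "f = (\<lambda>r. \<Sum>p\<in>P. a p * snd p r)"
      using P unfolding generates_def by blast
    show "\<exists>a \<in> strand (card P) (\<lambda>c. fst (e c)) b. f = (\<lambda>r. \<Sum>c<card P. snd (e c) r * a c)"
    proof
      show "f = (\<lambda>r. \<Sum>c<card P. snd (e c) r * (if c < card P then a (e c) else 0))"
        by (simp add: a(2) reindex mult.commute)
      show "(\<lambda>c. if c < card P then a (e c) else 0) \<in> strand (card P) (\<lambda>c. fst (e c)) b"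
        using a(1) by (auto simp: strand_def)
    qed
  next
    fix b a c
    assume a: "a \<in> strand (card P) (\<lambda>c. fst (e c)) b"
      and rel: "(\<lambda>r. \<Sum>c<card P. snd (e c) r * a c) = 0" and c: "fst (e c) = b"
    show "a c = 0"
    proof (rule ccontr)
      assume nz: "a c \<noteq> 0"
      then have cP: "c < card P" using a by (auto simp: strand_def)
      let ?a = "\<lambda>p. if p \<in> P then a (i p) else 0"
      have "generates (P - {e c}) W"
      proof (rule generates_remove[OF P, where a = ?a])
        fix p assume p: "?a p \<noteq> 0"
        then have "p \<in> P" by (auto split: if_splits)
        then obtain l where l: "l < card P" "p = e l" using e by (auto simp: bij_betw_def)
        then show "p \<in> P \<and> fst p \<le> fst (e c)"
          using p a c ie[OF l(1)] \<open>p \<in> P\<close> by (auto simp: strand_def)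
      next
        fix r
        have "(\<Sum>p\<in>P. ?a p * snd p r) = (\<Sum>c<card P. snd (e c) r * a c)"
          unfolding reindex by (intro sum.cong) (auto simp: ie eP)
        then show "(\<Sum>p\<in>P. ?a p * snd p r) = 0" using fun_cong[OF rel, of r] by simp
      next
        show "?a (e c) \<noteq> 0" using nz cP by (simp add: ie eP)
      qed
      then have "card P \<le> card (P - {e c})" by (rule least)
      then show False using eP[OF cP] fin by (metis card_Diff1_less leD)
    qed
  qed
qed

lemma kernel_lin_closed:
  fixes D :: "nat \<Rightarrow> nat \<Rightarrow> 'k::field"
  shows "lin_closed {a \<in> strand m h b. (\<lambda>r. \<Sum>c<m. D r c * a c) = 0}"
  unfolding lin_closed_def
proof (intro conjI ballI allI)
  show "0 \<in> {a \<in> strand m h b. (\<lambda>r. \<Sum>c<m. D r c * a c) = 0}"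
    by (auto simp: strand_def)
next
  fix x y :: "nat \<Rightarrow> 'k" and s
  assume x: "x \<in> {a \<in> strand m h b. (\<lambda>r. \<Sum>c<m. D r c * a c) = 0}"
    and y: "y \<in> {a \<in> strand m h b. (\<lambda>r. \<Sum>c<m. D r c * a c) = 0}"
  have "(\<Sum>c<m. D r c * (x c + s * y c)) = (\<Sum>c<m. D r c * x c) + s * (\<Sum>c<m. D r c * y c)" for r
    by (simp add: algebra_simps sum.distrib sum_distrib_left)
  moreover have "(\<Sum>c<m. D r c * x c) = 0" "(\<Sum>c<m. D r c * y c) = 0" for r
    using x y by (auto dest: fun_cong[of _ _ r])
  moreover have "(\<lambda>i. x i + s * y i) \<in> strand m h b"
    using x y unfolding strand_def by (auto, (metis add.right_neutral mult_zero_right add_0)+)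
  ultimately show "(\<lambda>i. x i + s * y i) \<in> {a \<in> strand m h b. (\<lambda>r. \<Sum>c<m. D r c * a c) = 0}"
    by (simp add: zero_fun_def)
qed

lemma strand_mono: "b \<le> b' \<Longrightarrow> strand N G b \<subseteq> strand N G b'"
  unfolding strand_def by (auto intro: order_trans)

text \<open>
The strand in degree \<open>b\<close> depends only on the set of basis degrees below \<open>b\<close>, so it already occurs in
degree equal to the join of this set. Hence the kernel of any homogeneous map has finitely many
jumps.
\<close>

lemma strand_jumps:
  fixes h :: "nat \<Rightarrow> 'n \<Rightarrow> nat"
  shows "\<exists>J. finite J \<and> (\<forall>b. \<exists>j \<in> J. j \<le> b \<and> (strand m h b :: (nat \<Rightarrow> 'k::field) set) \<subseteq> strand m h j)"
proof -
  \<comment> \<open>Inserting \<open>0\<close> gives the empty set the join \<open>0\<close>.\<close>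
  define join where "join S i = Max (insert 0 ((\<lambda>c. h c i) ` S))" for S :: "nat set" and i
  have "\<exists>j \<in> join ` Pow {..<m}. j \<le> b \<and> (strand m h b :: (nat \<Rightarrow> 'k) set) \<subseteq> strand m h j" for b
  proof
    let ?S = "{c \<in> {..<m}. h c \<le> b}"
    have "join ?S i \<le> b i" for i
      unfolding join_def by (subst Max_le_iff) (auto simp: le_fun_def)
    moreover have "h c i \<le> join ?S i" if "c \<in> ?S" for c i
      unfolding join_def using that by (intro Max_ge) auto
    ultimately show "join ?S \<le> b \<and> (strand m h b :: (nat \<Rightarrow> 'k) set) \<subseteq> strand m h (join ?S)"
      unfolding strand_def le_fun_def by auto
  qed auto
  then show ?thesis by (intro exI[of _ "join ` Pow {..<m}"]) auto
qed

lemma syzygy_family_step: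
  fixes W :: "('n \<Rightarrow> nat) \<Rightarrow> (nat \<Rightarrow> 'k::field) set"
  assumes W: "syzygy_family N G W"
  shows "\<exists>m h D. (\<forall>r c. D r c \<noteq> 0 \<longrightarrow> r < N \<and> G r < h c) \<and>
    (\<forall>b. (\<lambda>a r. \<Sum>c<m. D r c * a c) ` strand m h b = W b) \<and>
    syzygy_family m h (\<lambda>b. {a \<in> strand m h b. (\<lambda>r. \<Sum>c<m. D r c * a c) = 0})"
proof -
  obtain m h w where *: "(\<forall>c<m. w c \<in> W (h c)) \<and>
    (\<forall>b. \<forall>f \<in> W b. \<exists>a \<in> strand m h b. f = (\<lambda>r. \<Sum>c<m. w c r * a c)) \<and>
    (\<forall>b. \<forall>a \<in> strand m h b. (\<lambda>r. \<Sum>c<m. w c r * a c) = 0 \<longrightarrow> (\<forall>c. h c = b \<longrightarrow> a c = 0))"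
    using minimal_generators[OF W] by (elim exE)
  note w = *[THEN conjunct1, rule_format]
    and gen = *[THEN conjunct2, THEN conjunct1, rule_format]
    and min = *[THEN conjunct2, THEN conjunct2, rule_format]
  define D where "D r c = (if c < m then w c r else 0)" for r c
  have D: "(\<lambda>r. \<Sum>c<m. D r c * a c) = (\<lambda>r. \<Sum>c<m. w c r * a c)" for a
    by (simp add: D_def)
  have "r < N \<and> G r < h c" if "D r c \<noteq> 0" for r c
  proof -
    have c: "c < m" "w c r \<noteq> 0" using that by (auto simp: D_def split: if_splits)
    then have "r < N" "G r \<le> h c" "G r \<noteq> h c"
      using w[OF c(1)] W unfolding syzygy_family_def strand_def by blast+
    then show ?thesis by auto
  qed
  moreover have "(\<lambda>a r. \<Sum>c<m. D r c * a c) ` strand m h b = W b" for b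
  proof (intro equalityI subsetI)
    fix f assume "f \<in> (\<lambda>a r. \<Sum>c<m. D r c * a c) ` strand m h b"
    then obtain a where a: "a \<in> strand m h b" "f = (\<lambda>r. \<Sum>c<m. a c * w c r)"
      unfolding D by (auto simp: mult.commute)
    have "w c \<in> W b" if "c < m" "a c \<noteq> 0" for c
      using w[OF that(1)] W a(1) that(2) unfolding syzygy_family_def strand_def
      by (blast dest: monoD)
    then show "f \<in> W b" unfolding a(2)
      using W by (intro lin_closed_sum) (auto simp: syzygy_family_def)
  next
    fix f assume "f \<in> W b"
    from gen[OF this] show "f \<in> (\<lambda>a r. \<Sum>c<m. D r c * a c) ` strand m h b" unfolding D by blast
  qed
  moreover have "syzygy_family m h (\<lambda>b. {a \<in> strand m h b. (\<lambda>r. \<Sum>c<m. D r c * a c) = 0})"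
    unfolding syzygy_family_def
  proof (intro conjI allI)
    show "mono (\<lambda>b. {a \<in> strand m h b. (\<lambda>r. \<Sum>c<m. D r c * a c) = 0})"
      using strand_mono by (intro monoI) blast
    show "\<exists>J. finite J \<and> (\<forall>b. \<exists>j\<in>J. j \<le> b \<and> {a \<in> strand m h b. (\<lambda>r. \<Sum>c<m. D r c * a c) = 0}
        \<subseteq> {a \<in> strand m h j. (\<lambda>r. \<Sum>c<m. D r c * a c) = 0})"
    proof -
      obtain J where J: "finite J"
        "\<And>b. \<exists>j \<in> J. j \<le> b \<and> (strand m h b :: (nat \<Rightarrow> 'k) set) \<subseteq> strand m h j"
        using strand_jumps[of m h, where 'k = 'k] by blast
      show ?thesis
      proof (intro exI conjI allI)
        fix b
        obtain j where "j \<in> J" "j \<le> b" "(strand m h b :: (nat \<Rightarrow> 'k) set) \<subseteq> strand m h j"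
          using J(2) by blast
        then show "\<exists>j\<in>J. j \<le> b \<and> {a \<in> strand m h b. (\<lambda>r. \<Sum>c<m. D r c * a c) = 0}
            \<subseteq> {a \<in> strand m h j. (\<lambda>r. \<Sum>c<m. D r c * a c) = 0}"
          by (intro bexI[of _ j]) auto
      qed (rule J(1))
    qed
  qed (use min D in \<open>auto intro: kernel_lin_closed\<close>)
  ultimately show ?thesis by blast
qed

text \<open>
The start of the construction, the kernel of the augmentation onto \<open>S/M\<close>. The free module has rank one
with generator in degree \<open>0\<close>, except that it is zero when \<open>M\<close> contains \<open>1\<close>.
\<close>

lemma monomial_syzygy_family:
  fixes I :: "('n::finite \<Rightarrow> nat) set"
  assumes upward: "\<And>b b'. b \<in> I \<Longrightarrow> b \<le> b' \<Longrightarrow> b' \<in> I"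
  defines "N \<equiv> if 0 \<in> I then 0 else 1 :: nat"
  shows "syzygy_family N (\<lambda>_. 0) (\<lambda>b. {f :: nat \<Rightarrow> 'k::field. f \<in> strand N (\<lambda>_. 0) b \<and> (b \<in> I \<or> (\<Sum>c<N. f c) = 0)})"
    (is "syzygy_family N _ ?W")
  unfolding syzygy_family_def
proof (intro conjI allI)
  have W: "?W b = {f. \<forall>c. f c \<noteq> 0 \<longrightarrow> c < N \<and> b \<in> I}" for b
    by (auto simp: strand_def N_def le_fun_def)
  fix b
  show "lin_closed (?W b)" unfolding W lin_closed_def by auto (metis add_0 mult_zero_right)+
  show "?W b \<subseteq> strand N (\<lambda>_. 0) b" by blast
  show "mono ?W" unfolding W using upward by (intro monoI) blast
  obtain J where J: "finite J" "J \<subseteq> I" "\<And>b. b \<in> I \<Longrightarrow> \<exists>j \<in> J. j \<le> b"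
    using dickson[of I] by blast
  have "\<exists>j \<in> insert 0 J. j \<le> b \<and> ?W b \<subseteq> ?W j" for b
  proof (cases "b \<in> I")
    case True
    then show ?thesis using J(2) J(3)[of b] unfolding W by blast
  next
    case False
    then have "?W b \<subseteq> ?W 0" unfolding W by blast
    then show ?thesis by (auto simp: le_fun_def)
  qed
  then show "\<exists>J. finite J \<and> (\<forall>b. \<exists>j\<in>J. j \<le> b \<and> ?W b \<subseteq> ?W j)"
    using J(1) by (intro exI[of _ "insert 0 J"]) auto
  show "\<forall>f \<in> ?W b. \<forall>c. 0 = b \<longrightarrow> f c = 0"
    unfolding W by (auto simp: N_def split: if_splits)
qed

theorem scalar_resolution_ex:
  fixes I :: "('n::finite \<Rightarrow> nat) set"
  assumes upward: "\<And>b b'. b \<in> I \<Longrightarrow> b \<le> b' \<Longrightarrow> b' \<in> I"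
  shows "\<exists>\<beta> G (D :: nat \<Rightarrow> nat \<Rightarrow> nat \<Rightarrow> 'k::field). scalar_resolution I \<beta> G D (\<lambda>_. 1)"
proof -
  define N where "N = (if 0 \<in> I then 0 else 1 :: nat)"
  define W :: "('n \<Rightarrow> nat) \<Rightarrow> (nat \<Rightarrow> 'k) set" where
    "W b = {f. f \<in> strand N (\<lambda>_. 0) b \<and> (b \<in> I \<or> (\<Sum>c<N. f c) = 0)}" for b
  \<comment> \<open>A state consists of a free module, given by rank and degrees, and the kernel still to be resolved.\<close>
  define fam where "fam s \<longleftrightarrow> (case s of (N, G, W) \<Rightarrow> syzygy_family N G W)"
    for s :: "nat \<times> (nat \<Rightarrow> 'n \<Rightarrow> nat) \<times> (('n \<Rightarrow> nat) \<Rightarrow> (nat \<Rightarrow> 'k) set)"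
  define step where "step s s' \<longleftrightarrow> (case s of (N, G, W) \<Rightarrow> case s' of (m, h, W') \<Rightarrow>
      \<exists>D. (\<forall>r c. D r c \<noteq> 0 \<longrightarrow> r < N \<and> G r < h c) \<and>
        (\<forall>b. (\<lambda>a r. \<Sum>c<m. D r c * a c) ` strand m h b = W b) \<and>
        W' = (\<lambda>b. {a \<in> strand m h b. (\<lambda>r. \<Sum>c<m. D r c * a c) = 0}))"
    for s s' :: "nat \<times> (nat \<Rightarrow> 'n \<Rightarrow> nat) \<times> (('n \<Rightarrow> nat) \<Rightarrow> (nat \<Rightarrow> 'k) set)"
  have "fam (N, \<lambda>_. 0, W) \<longleftrightarrow> syzygy_family N (\<lambda>_. 0) W" by (simp add: fam_def)
  then have init: "fam (N, \<lambda>_. 0, W)"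
    unfolding N_def W_def[abs_def] by (rule iffD2) (rule monomial_syzygy_family, erule (1) upward)
  have "\<exists>\<sigma>. \<forall>p. (fam (\<sigma> p) \<and> (p = 0 \<longrightarrow> \<sigma> p = (N, \<lambda>_. 0, W))) \<and> step (\<sigma> p) (\<sigma> (Suc p))"
  proof (rule dependent_nat_choice)
    show "\<exists>s. fam s \<and> (0 = (0::nat) \<longrightarrow> s = (N, \<lambda>_. 0, W))" using init by blast
    fix s and p :: nat assume "fam s \<and> (p = 0 \<longrightarrow> s = (N, \<lambda>_. 0, W))"
    moreover obtain L H V where s: "s = (L, H, V)" by (metis prod.exhaust)
    ultimately have "syzygy_family L H V" by (simp add: fam_def)
    from syzygy_family_step[OF this] obtain m h D where
      D: "\<forall>r c. D r c \<noteq> 0 \<longrightarrow> r < L \<and> H r < h c"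
        "\<forall>b. (\<lambda>a r. \<Sum>c<m. D r c * a c) ` strand m h b = V b"
        "syzygy_family m h (\<lambda>b. {a \<in> strand m h b. (\<lambda>r. \<Sum>c<m. D r c * a c) = 0})"
      by (elim exE conjE)
    let ?s' = "(m, h, \<lambda>b. {a \<in> strand m h b. (\<lambda>r. \<Sum>c<m. D r c * a c) = 0})"
    have "step s ?s'" unfolding s step_def prod.case using D(1,2) by (intro exI[of _ D] conjI refl)
    moreover have "fam ?s'" using D(3) by (simp add: fam_def)
    ultimately show "\<exists>s'. (fam s' \<and> (Suc p = 0 \<longrightarrow> s' = (N, \<lambda>_. 0, W))) \<and> step s s'"
      by (intro exI[of _ ?s']) simp
  qed
  then obtain \<sigma> where \<sigma>0: "\<sigma> 0 = (N, \<lambda>_. 0, W)" and \<sigma>: "\<And>p. step (\<sigma> p) (\<sigma> (Suc p))" by blast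
  define \<beta> G V where "\<beta> p = fst (\<sigma> p)" and "G p = fst (snd (\<sigma> p))" and "V p = snd (snd (\<sigma> p))" for p
  have \<sigma>_eq: "\<sigma> p = (\<beta> p, G p, V p)" for p by (simp add: \<beta>_def G_def V_def)
  have "\<exists>D. (\<forall>r c. D r c \<noteq> 0 \<longrightarrow> r < \<beta> p \<and> G p r < G (Suc p) c) \<and>
        (\<forall>b. (\<lambda>a r. \<Sum>c<\<beta> (Suc p). D r c * a c) ` strand (\<beta> (Suc p)) (G (Suc p)) b = V p b) \<and>
        V (Suc p) = (\<lambda>b. {a \<in> strand (\<beta> (Suc p)) (G (Suc p)) b. (\<lambda>r. \<Sum>c<\<beta> (Suc p). D r c * a c) = 0})" for p
    using \<sigma>[of p] unfolding \<sigma>_eq step_def by simp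
  from choice[OF allI[OF this]] obtain D where D': "\<forall>p. (\<forall>r c. D p r c \<noteq> 0 \<longrightarrow> r < \<beta> p \<and> G p r < G (Suc p) c) \<and>
        (\<forall>b. (\<lambda>a r. \<Sum>c<\<beta> (Suc p). D p r c * a c) ` strand (\<beta> (Suc p)) (G (Suc p)) b = V p b) \<and>
        V (Suc p) = (\<lambda>b. {a \<in> strand (\<beta> (Suc p)) (G (Suc p)) b. (\<lambda>r. \<Sum>c<\<beta> (Suc p). D p r c * a c) = 0})" ..
  note D = D'[THEN spec, THEN conjunct1, rule_format]
    D'[THEN spec, THEN conjunct2, THEN conjunct1, rule_format]
    D'[THEN spec, THEN conjunct2, THEN conjunct2]
  have 0: "\<beta> 0 = N" "G 0 = (\<lambda>_. 0)" "V 0 = W" using \<sigma>0 \<sigma>_eq[of 0] by auto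
  have "scalar_resolution I \<beta> G D (\<lambda>_. 1)"
  proof
    show "b \<in> I \<Longrightarrow> b \<le> b' \<Longrightarrow> b' \<in> I" for b b' by (rule upward)
    show "D p r c \<noteq> 0 \<Longrightarrow> r < \<beta> p \<and> G p r < G (Suc p) c" for p r c by (rule D(1))
  next
    fix b assume "b \<notin> I"
    then have "0 \<notin> I" using upward[of 0 b] by (auto simp: le_fun_def)
    then show "\<exists>f \<in> strand (\<beta> 0) (G 0) b. (\<Sum>c<\<beta> 0. 1 * f c) \<noteq> (0::'k)"
      by (intro bexI[of _ "\<lambda>c. of_bool (c = 0)"]) (auto simp: 0 N_def strand_def le_fun_def)
  next
    fix f :: "nat \<Rightarrow> 'k" and b assume "f \<in> strand (\<beta> 0) (G 0) b"
    moreover have "(\<exists>h \<in> strand (\<beta> 1) (G 1) b. (\<lambda>r. \<Sum>c<\<beta> 1. D 0 r c * h c) = f) \<longleftrightarrow> f \<in> V 0 b"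
      unfolding D(2)[of 0 b, symmetric] by auto
    ultimately show "(\<exists>h \<in> strand (\<beta> 1) (G 1) b. (\<lambda>r. \<Sum>c<\<beta> 1. D 0 r c * h c) = f)
        \<longleftrightarrow> b \<in> I \<or> (\<Sum>c<\<beta> 0. 1 * f c) = 0"
      by (simp add: 0 W_def)
  next
    fix f :: "nat \<Rightarrow> 'k" and p b assume "f \<in> strand (\<beta> (Suc p)) (G (Suc p)) b"
    moreover have "(\<exists>h \<in> strand (\<beta> (Suc (Suc p))) (G (Suc (Suc p))) b.
        (\<lambda>r. \<Sum>c<\<beta> (Suc (Suc p)). D (Suc p) r c * h c) = f) \<longleftrightarrow> f \<in> V (Suc p) b"
      unfolding D(2)[of "Suc p" b, symmetric] by auto
    ultimately show "(\<exists>h \<in> strand (\<beta> (Suc (Suc p))) (G (Suc (Suc p))) b.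
        (\<lambda>r. \<Sum>c<\<beta> (Suc (Suc p)). D (Suc p) r c * h c) = f)
        \<longleftrightarrow> (\<lambda>r. \<Sum>c<\<beta> (Suc p). D p r c * f c) = 0"
      by (simp add: D(3))
  qed
  then show ?thesis by blast
qed

section \<open>Monomial ideals in the polynomial ring\<close>

abbreviation lookup :: "('a \<Rightarrow>\<^sub>0 'b::zero) \<Rightarrow> 'a \<Rightarrow> 'b" where
  "lookup \<equiv> Poly_Mapping.lookup"

abbreviation keys :: "('a \<Rightarrow>\<^sub>0 'b::zero) \<Rightarrow> 'a set" where
  "keys \<equiv> Poly_Mapping.keys"

lemma lookup_surj: "\<exists>b. lookup b = (f :: 'n::finite \<Rightarrow> nat)"
  by (intro exI[of _ "Abs_poly_mapping f"] lookup_Abs_poly_mapping) simp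

lemma lookup_le_add: "lookup a \<le> lookup (a + b :: 'n \<Rightarrow>\<^sub>0 nat)"
  by (simp add: le_fun_def lookup_add)

lemma add_diff_exponent: "lookup a \<le> lookup b \<Longrightarrow> a + (b - a) = (b :: 'n \<Rightarrow>\<^sub>0 nat)"
  by (intro poly_mapping_eqI) (simp add: lookup_add lookup_minus le_fun_def)

lemma poly_mapping_sum_single: "p = (\<Sum>t \<in> keys p. Poly_Mapping.single t (lookup p t))"
proof (rule poly_mapping_eqI)
  fix s
  have "lookup (\<Sum>t \<in> keys p. Poly_Mapping.single t (lookup p t)) s
      = (\<Sum>t \<in> keys p. if t = s then lookup p s else 0)"
    unfolding lookup_sum by (intro sum.cong refl) (auto simp: lookup_single)
  then show "lookup p s = lookup (\<Sum>t \<in> keys p. Poly_Mapping.single t (lookup p t)) s"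
    by (simp add: in_keys_iff)
qed

lemma ideal_gen_monomials:
  "ideal_gen (monom_of ` A :: ('n, 'k::field) mpoly set)
    = {p. \<forall>t \<in> keys p. \<exists>a \<in> A. lookup a \<le> lookup t}" (is "_ = ?T")
proof -
  interpret m: Modules.module "(*) :: ('n, 'k) mpoly \<Rightarrow> _"
    by unfold_locales (simp_all add: algebra_simps)
  show ?thesis unfolding ideal_gen_def
  proof
    show "m.span (monom_of ` A) \<subseteq> ?T"
    proof (rule m.span_minimal)
      show "monom_of ` A \<subseteq> ?T" by (auto simp: monom_of_def)
      show "m.subspace ?T"
      proof (rule m.subspaceI)
        fix p q :: "('n, 'k) mpoly" assume "p \<in> ?T" "q \<in> ?T"
        then show "p + q \<in> ?T" using keys_add[of p q] by blast
      next
        fix c p :: "('n, 'k) mpoly" assume p: "p \<in> ?T"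
        have "\<exists>a \<in> A. lookup a \<le> lookup t" if "t \<in> keys (c * p)" for t
        proof -
          have "t \<in> {a + b |a b. a \<in> keys c \<and> b \<in> keys p}" using that keys_mult by (rule rev_subsetD)
          then obtain s r where t: "t = s + r" "r \<in> keys p" by blast
          then obtain a where "a \<in> A" "lookup a \<le> lookup r" using p by blast
          moreover have "lookup r \<le> lookup t" using lookup_le_add[of r s] t by (simp add: add.commute)
          ultimately show ?thesis by (meson order_trans)
        qed
        then show "c * p \<in> ?T" by blast
      qed simp
    qed
    show "?T \<subseteq> m.span (monom_of ` A)"
    proof
      fix p :: "('n, 'k) mpoly" assume p: "p \<in> ?T"
      have "Poly_Mapping.single t (lookup p t) \<in> m.span (monom_of ` A)" if "t \<in> keys p" for t
      proof -
        have "\<exists>a \<in> A. lookup a \<le> lookup t" using p that by simp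
        then obtain a where a: "a \<in> A" "lookup a \<le> lookup t" ..
        have "(t - a) + a = t" using add_diff_exponent[OF a(2)] by (simp add: add.commute)
        then have "Poly_Mapping.single t (lookup p t)
            = Poly_Mapping.single (t - a) (lookup p t) * monom_of a"
          by (simp add: monom_of_def mult_single)
        then show ?thesis using a(1) by (simp add: m.span_base m.span_scale)
      qed
      then have "(\<Sum>t \<in> keys p. Poly_Mapping.single t (lookup p t)) \<in> m.span (monom_of ` A)"
        by (rule m.span_sum)
      then show "p \<in> m.span (monom_of ` A)" by (rule subst[where P = "\<lambda>x. x \<in> m.span (monom_of ` A)", OF poly_mapping_sum_single[of p, symmetric]])
    qed
  qed
qed

lemma max_ideal_iff: "p \<in> max_ideal \<longleftrightarrow> lookup p 0 = 0"
proof -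
  let ?X = "range (\<lambda>i. Poly_Mapping.single i 1) :: ('a \<Rightarrow>\<^sub>0 nat) set"
  have "max_ideal = (ideal_gen (monom_of ` ?X) :: ('a, 'b) mpoly set)"
    unfolding max_ideal_def by (simp add: image_image)
  moreover have "(\<exists>a \<in> ?X. lookup a \<le> lookup t) \<longleftrightarrow> t \<noteq> 0" for t
  proof
    assume "t \<noteq> 0"
    then obtain i where "lookup t i \<noteq> 0" by (metis lookup_zero poly_mapping_eqI)
    then have "lookup (Poly_Mapping.single i 1) \<le> lookup t"
      by (auto simp: le_fun_def lookup_single when_def)
    then show "\<exists>a \<in> ?X. lookup a \<le> lookup t" by blast
  next
    assume "\<exists>a \<in> ?X. lookup a \<le> lookup t"
    then obtain i where "lookup (Poly_Mapping.single i 1) \<le> lookup t" by blast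
    then show "t \<noteq> 0" using le_funD[of "lookup (Poly_Mapping.single i 1)" "lookup t" i] by auto
  qed
  ultimately have "max_ideal = {p :: ('a, 'b) mpoly. \<forall>t \<in> keys p. t \<noteq> 0}"
    by (simp only: ideal_gen_monomials)
  then have "p \<in> max_ideal \<longleftrightarrow> 0 \<notin> keys p" by auto
  then show ?thesis by (simp add: in_keys_iff)
qed

lemma lookup_single_mult:
  fixes q :: "('n, 'k::field) mpoly"
  shows "lookup (Poly_Mapping.single t a * q) (t + x) = a * lookup q x"
  by (simp add: lookup_mult lookup_single when_mult)

text \<open>
The polynomial \<open>p\<close> is a monomial of degree \<open>e - s\<close> up to a scalar, as is an entry of a homogeneous matrix
with row degree \<open>s\<close> and column degree \<open>e\<close>. The lemma reads off one coefficient of a product with such an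
entry in terms of the total degree \<open>b\<close>.
\<close>

lemma lookup_mult_homogeneous:
  fixes p q :: "('n, 'k::field) mpoly"
  assumes hom: "\<And>t. t \<in> keys p \<Longrightarrow> s + t = e" and b: "lookup s \<le> lookup b"
  shows "lookup (p * q) (b - s)
    = lookup p (e - s) * (if lookup e \<le> lookup b then lookup q (b - e) else 0)"
proof (cases "p = 0")
  case False
  then obtain t where t: "t \<in> keys p" by (metis in_keys_iff lookup_zero poly_mapping_eqI)
  then have e: "e = s + t" using hom by simp
  have "p = Poly_Mapping.single t (lookup p t)"
  proof (rule poly_mapping_eqI)
    fix r show "lookup p r = lookup (Poly_Mapping.single t (lookup p t)) r"
      using hom[of r] e by (cases "r = t") (auto simp: lookup_single in_keys_iff)
  qed
  then have prod: "p * q = Poly_Mapping.single t (lookup p t) * q" by simp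
  show ?thesis
  proof (cases "lookup e \<le> lookup b")
    case True
    then have "s + (b - s) = s + (t + (b - e))"
      using add_diff_exponent[OF True] add_diff_exponent[OF b] e by (simp add: add.assoc)
    then have "b - s = t + (b - e)" by simp
    then show ?thesis using True by (simp add: prod lookup_single_mult e)
  next
    case False
    have "b - s \<notin> keys (p * q)"
    proof
      assume "b - s \<in> keys (p * q)"
      then have "b - s \<in> {t + x |t x. t \<in> keys p \<and> x \<in> keys q}" using keys_mult by (rule rev_subsetD)
      then obtain r x where "b - s = r + x" "r \<in> keys p" by blast
      then have "b = e + x" using add_diff_exponent[OF b] hom[of r] by (metis add.assoc)
      then show False using False lookup_le_add by blast
    qed
    then show ?thesis using False by (simp add: in_keys_iff)
  qed
qed simp

section \<open>Homogeneous components of vectors and matrices\<close>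

text \<open>
Basis vector \<open>c\<close> has degree \<open>g c\<close>, so total degree \<open>b\<close> means exponent \<open>b - g c\<close> in entry \<open>c\<close>. The test is
needed because the subtraction of exponents truncates.
\<close>

definition component ::
  "(nat \<Rightarrow> 'n \<Rightarrow>\<^sub>0 nat) \<Rightarrow> ('n \<Rightarrow>\<^sub>0 nat) \<Rightarrow> ('n, 'k::field) mpoly vec \<Rightarrow> nat \<Rightarrow> 'k" where
  "component g b v c =
    (if c < dim_vec v \<and> lookup (g c) \<le> lookup b then lookup (v $ c) (b - g c) else 0)"

abbreviation strand_of ::
  "nat \<Rightarrow> (nat \<Rightarrow> 'n \<Rightarrow>\<^sub>0 nat) \<Rightarrow> ('n \<Rightarrow>\<^sub>0 nat) \<Rightarrow> (nat \<Rightarrow> 'k::field) set" where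
  "strand_of N g b \<equiv> strand N (\<lambda>c. lookup (g c)) (lookup b)"

lemma component_in_strand: "v \<in> carrier_vec N \<Longrightarrow> component g b v \<in> strand_of N g b"
  by (auto simp: strand_def component_def)

lemma component_eqI:
  assumes v: "v \<in> carrier_vec N" and w: "w \<in> carrier_vec N"
    and eq: "\<And>b. component g b v = component g b w"
  shows "v = w"
proof (rule eq_vecI)
  fix c assume c: "c < dim_vec w"
  show "v $ c = w $ c"
  proof (rule poly_mapping_eqI)
    fix t
    show "lookup (v $ c) t = lookup (w $ c) t"
      using fun_cong[OF eq[of "g c + t"], of c] v w c by (simp add: component_def lookup_le_add)
  qed
qed (use v w in simp)

lemma finite_components: "finite {b. component g b v \<noteq> 0}"
proof (rule finite_subset)
  show "{b. component g b v \<noteq> 0} \<subseteq> (\<Union>c<dim_vec v. (\<lambda>t. g c + t) ` keys (v $ c))"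
  proof
    fix b assume "b \<in> {b. component g b v \<noteq> 0}"
    then obtain c where c: "component g b v c \<noteq> 0" by (auto simp: fun_eq_iff)
    then have *: "c < dim_vec v" "lookup (g c) \<le> lookup b" "b - g c \<in> keys (v $ c)"
      by (auto simp: component_def in_keys_iff split: if_splits)
    then have "b \<in> (\<lambda>t. g c + t) ` keys (v $ c)"
      using add_diff_exponent[OF *(2)] by (metis imageI)
    then show "b \<in> (\<Union>c<dim_vec v. (\<lambda>t. g c + t) ` keys (v $ c))" using *(1) by blast
  qed
qed simp

text \<open>
A vector is the same as a finitely supported family of strand elements.
\<close>

lemma assemble_components:
  fixes f :: "('n \<Rightarrow>\<^sub>0 nat) \<Rightarrow> nat \<Rightarrow> 'k::field"
  assumes fin: "finite {b. f b \<noteq> 0}" and f: "\<And>b. f b \<in> strand_of N g b"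
  shows "\<exists>v \<in> carrier_vec N. \<forall>b. component g b v = f b"
proof -
  define v where "v = vec N (\<lambda>c. Abs_poly_mapping (\<lambda>t. f (g c + t) c))"
  have lookup_v: "lookup (v $ c) t = f (g c + t) c" if "c < N" for c t
  proof -
    have "finite ((\<lambda>t. g c + t) -` {b. f b \<noteq> 0})"
      by (rule finite_vimageI[OF fin]) (simp add: inj_def)
    moreover have "{t. f (g c + t) c \<noteq> 0} \<subseteq> (\<lambda>t. g c + t) -` {b. f b \<noteq> 0}"
      by (auto simp: fun_eq_iff)
    ultimately have "finite {t. f (g c + t) c \<noteq> 0}" by (rule finite_subset[rotated])
    then show ?thesis using that by (simp add: v_def)
  qed
  have "component g b v c = f b c" for b c
  proof (cases "c < N \<and> lookup (g c) \<le> lookup b")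
    case True
    then show ?thesis by (simp add: component_def lookup_v add_diff_exponent) (simp add: v_def)
  next
    case False
    then show ?thesis using f[of b] by (auto simp: component_def v_def strand_def)
  qed
  moreover have "v \<in> carrier_vec N" by (simp add: v_def)
  ultimately show ?thesis by blast
qed

lemma assemble_component:
  fixes f :: "nat \<Rightarrow> 'k::field"
  assumes "f \<in> strand_of N g b"
  obtains v where "v \<in> carrier_vec N" "component g b v = f" "\<And>b'. b' \<noteq> b \<Longrightarrow> component g b' v = 0"
proof -
  have "\<exists>v \<in> carrier_vec N. \<forall>b'. component g b' v = (if b' = b then f else 0)"
    by (rule assemble_components) (use assms in \<open>auto simp: strand_def\<close>)
  then show ?thesis using that by fastforce
qed

definition homogeneous_matrix ::
  "(nat \<Rightarrow> 'n \<Rightarrow>\<^sub>0 nat) \<Rightarrow> (nat \<Rightarrow> 'n \<Rightarrow>\<^sub>0 nat) \<Rightarrow> ('n, 'k::field) mpoly mat \<Rightarrow> bool" where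
  "homogeneous_matrix g' g A \<longleftrightarrow>
    (\<forall>r < dim_row A. \<forall>c < dim_col A. \<forall>t \<in> keys (A $$ (r, c)). g' r + t = g c)"

text \<open>
The scalar in front of the only monomial that the entry of a homogeneous matrix can contain.
\<close>

definition coefficient ::
  "(nat \<Rightarrow> 'n \<Rightarrow>\<^sub>0 nat) \<Rightarrow> (nat \<Rightarrow> 'n \<Rightarrow>\<^sub>0 nat) \<Rightarrow> ('n, 'k::field) mpoly mat \<Rightarrow> nat \<Rightarrow> nat \<Rightarrow> 'k" where
  "coefficient g' g A r c =
    (if r < dim_row A \<and> c < dim_col A then lookup (A $$ (r, c)) (g c - g' r) else 0)"

definition apply_coefficients ::
  "(nat \<Rightarrow> 'n \<Rightarrow>\<^sub>0 nat) \<Rightarrow> (nat \<Rightarrow> 'n \<Rightarrow>\<^sub>0 nat) \<Rightarrow> ('n, 'k::field) mpoly mat \<Rightarrow> (nat \<Rightarrow> 'k) \<Rightarrow> nat \<Rightarrow> 'k" where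
  "apply_coefficients g' g A f = (\<lambda>r. \<Sum>c<dim_col A. coefficient g' g A r c * f c)"

lemma homogeneous_coefficient_le:
  assumes "homogeneous_matrix g' g A" "coefficient g' g A r c \<noteq> 0"
  shows "r < dim_row A" "c < dim_col A" "g c = g' r + (g c - g' r)" "lookup (g' r) \<le> lookup (g c)"
proof -
  show *: "r < dim_row A" "c < dim_col A" using assms(2) by (auto simp: coefficient_def split: if_splits)
  then have "g c - g' r \<in> keys (A $$ (r, c))"
    using assms(2) by (auto simp: coefficient_def in_keys_iff split: if_splits)
  then show g: "g c = g' r + (g c - g' r)" using assms(1) * unfolding homogeneous_matrix_def by metis
  show "lookup (g' r) \<le> lookup (g c)" by (subst g) (rule lookup_le_add)
qed

lemma component_mult_mat_vec:
  assumes hom: "homogeneous_matrix g' g A" and v: "v \<in> carrier_vec (dim_col A)"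
  shows "component g' b (A *\<^sub>v v) = apply_coefficients g' g A (component g b v)"
proof
  fix r
  show "component g' b (A *\<^sub>v v) r = apply_coefficients g' g A (component g b v) r"
  proof (cases "r < dim_row A \<and> lookup (g' r) \<le> lookup b")
    case True
    have "component g' b (A *\<^sub>v v) r = lookup (\<Sum>c<dim_col A. A $$ (r, c) * v $ c) (b - g' r)"
      using True v by (simp add: component_def scalar_prod_def lessThan_atLeast0)
    also have "\<dots> = (\<Sum>c<dim_col A. lookup (A $$ (r, c) * v $ c) (b - g' r))"
      by (rule lookup_sum)
    also have "\<dots> = (\<Sum>c<dim_col A. coefficient g' g A r c * component g b v c)"
    proof (rule sum.cong[OF refl])
      fix c assume c: "c \<in> {..<dim_col A}"
      then have "\<And>t. t \<in> keys (A $$ (r, c)) \<Longrightarrow> g' r + t = g c"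
        using hom True unfolding homogeneous_matrix_def by blast
      from lookup_mult_homogeneous[OF this, where b = b and q = "v $ c"] show
        "lookup (A $$ (r, c) * v $ c) (b - g' r) = coefficient g' g A r c * component g b v c"
        using True c v by (simp add: coefficient_def component_def)
    qed
    finally show ?thesis by (simp add: apply_coefficients_def)
  next
    case False
    have "coefficient g' g A r c * component g b v c = 0" for c
    proof (rule ccontr)
      assume "\<not> ?thesis"
      then have "coefficient g' g A r c \<noteq> 0" "lookup (g c) \<le> lookup b"
        by (auto simp: component_def split: if_splits)
      then show False
        using homogeneous_coefficient_le[OF hom, of r c] False by (meson order_trans)
    qed
    then show ?thesis using False by (auto simp: component_def apply_coefficients_def)
  qed
qed

lemma lookup_augmentation:
  fixes u v :: "('n, 'k::field) mpoly vec"
  assumes hom: "\<And>c t. c < N \<Longrightarrow> t \<in> keys (u $ c) \<Longrightarrow> t = g c"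
    and v: "v \<in> carrier_vec N"
  shows "lookup (u \<bullet> v) b = (\<Sum>c<N. lookup (u $ c) (g c) * component g b v c)"
proof -
  have "lookup (u \<bullet> v) b = (\<Sum>c<N. lookup (u $ c * v $ c) b)"
    using v by (simp add: scalar_prod_def lookup_sum lessThan_atLeast0)
  also have "\<dots> = (\<Sum>c<N. lookup (u $ c) (g c) * component g b v c)"
  proof (rule sum.cong[OF refl])
    fix c assume c: "c \<in> {..<N}"
    then have "\<And>t. t \<in> keys (u $ c) \<Longrightarrow> 0 + t = g c" using hom by simp
    from lookup_mult_homogeneous[OF this, where b = b and q = "v $ c"]
    show "lookup (u $ c * v $ c) b = lookup (u $ c) (g c) * component g b v c"
      using c v by (simp add: component_def le_fun_def)
  qed
  finally show ?thesis .
qed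

text \<open>
A homogeneous image is compared with a submodule that is described by a condition \<open>Q\<close> on homogeneous
components. Both directions decompose vectors into components; in the converse, preimages are chosen
strand by strand and assembled, taking \<open>0\<close> as preimage of \<open>0\<close> so that only finitely many are nonzero.
\<close>

lemma mat_image_eq_iff:
  fixes B :: "('n, 'k::field) mpoly mat" and Q :: "('n \<Rightarrow>\<^sub>0 nat) \<Rightarrow> (nat \<Rightarrow> 'k) \<Rightarrow> bool"
  assumes hom: "homogeneous_matrix g h B" and B: "B \<in> carrier_mat N K" and Q0: "\<And>b. Q b 0"
  shows "mat_image B = {v \<in> carrier_vec N. \<forall>b. Q b (component g b v)} \<longleftrightarrow>
    (\<forall>b. \<forall>f \<in> strand_of N g b.
      (\<exists>x \<in> strand_of K h b. apply_coefficients g h B x = f) \<longleftrightarrow> Q b f)" (is "?L \<longleftrightarrow> ?R")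
proof
  assume L: ?L
  show ?R
  proof (intro allI ballI iffI)
    fix b f assume "f \<in> strand_of N g b" "\<exists>x \<in> strand_of K h b. apply_coefficients g h B x = f"
    then obtain x where x: "x \<in> strand_of K h b" "apply_coefficients g h B x = f" by blast
    from x(1) obtain w where w: "w \<in> carrier_vec K" "component h b w = x"
      by (rule assemble_component)
    then have "B *\<^sub>v w \<in> mat_image B" using B by (auto simp: mat_image_def)
    then have "Q b (component g b (B *\<^sub>v w))" using L by blast
    then show "Q b f" using component_mult_mat_vec[OF hom, of w b] w x B by simp
  next
    fix b f assume f: "f \<in> strand_of N g b" "Q b f"
    from f(1) obtain v where v: "v \<in> carrier_vec N" "component g b v = f"
      "\<And>b'. b' \<noteq> b \<Longrightarrow> component g b' v = 0" by (rule assemble_component) (rule that)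
    then have "Q b' (component g b' v)" for b' using f(2) Q0 by (cases "b' = b") auto
    then have "v \<in> mat_image B" using v(1) L by blast
    then obtain w where w: "w \<in> carrier_vec K" "v = B *\<^sub>v w" using B by (auto simp: mat_image_def)
    have "apply_coefficients g h B (component h b w) = f"
      using component_mult_mat_vec[OF hom, of w b] w v(2) B by simp
    then show "\<exists>x \<in> strand_of K h b. apply_coefficients g h B x = f"
      using component_in_strand[OF w(1)] by blast
  qed
next
  assume R: ?R
  show ?L
  proof (intro equalityI subsetI)
    fix v assume "v \<in> mat_image B"
    then obtain w where w: "w \<in> carrier_vec K" "v = B *\<^sub>v w" using B by (auto simp: mat_image_def)
    have v: "v \<in> carrier_vec N" using w B by simp
    have "Q b (component g b v)" for b
      using R component_in_strand[OF v] component_in_strand[OF w(1)]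
        component_mult_mat_vec[OF hom, of w b] w B by (metis carrier_matD(2))
    then show "v \<in> {v \<in> carrier_vec N. \<forall>b. Q b (component g b v)}" using v by blast
  next
    fix v assume "v \<in> {v \<in> carrier_vec N. \<forall>b. Q b (component g b v)}"
    then have v: "v \<in> carrier_vec N" "\<And>b. Q b (component g b v)" by auto
    have "\<exists>x \<in> strand_of K h b. apply_coefficients g h B x = component g b v \<and>
        (component g b v = 0 \<longrightarrow> x = 0)" for b
    proof (cases "component g b v = 0")
      case True
      then show ?thesis
        by (intro bexI[of _ 0]) (auto simp: apply_coefficients_def strand_def zero_fun_def)
    next
      case False
      then show ?thesis using R component_in_strand[OF v(1)] v(2) by blast
    qed
    then obtain x where x: "\<And>b. x b \<in> strand_of K h b"
      "\<And>b. apply_coefficients g h B (x b) = component g b v"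
      "\<And>b. component g b v = 0 \<Longrightarrow> x b = 0" by metis
    have "{b. x b \<noteq> 0} \<subseteq> {b. component g b v \<noteq> 0}" using x(3) by blast
    then have "finite {b. x b \<noteq> 0}" by (rule finite_subset[OF _ finite_components])
    then have "\<exists>w \<in> carrier_vec K. \<forall>b. component h b w = x b"
      using x(1) by (rule assemble_components)
    then obtain w where w: "w \<in> carrier_vec K" "\<And>b. component h b w = x b" by blast
    have "v = B *\<^sub>v w"
    proof (rule component_eqI)
      show "component g b v = component g b (B *\<^sub>v w)" for b
        using component_mult_mat_vec[OF hom, of w b] w x(2) B by simp
    qed (use v w B in auto)
    then show "v \<in> mat_image B" using w(1) B by (auto simp: mat_image_def)
  qed
qed

lemma mat_image_eq_kernel_iff:
  fixes A B :: "('n, 'k::field) mpoly mat"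
  assumes A: "homogeneous_matrix g' g A" "A \<in> carrier_mat m N"
    and B: "homogeneous_matrix g h B" "B \<in> carrier_mat N K"
  shows "mat_image B = mat_kernel A \<longleftrightarrow>
    (\<forall>b. \<forall>f \<in> strand_of N g b.
      (\<exists>x \<in> strand_of K h b. apply_coefficients g h B x = f) \<longleftrightarrow> apply_coefficients g' g A f = 0)"
proof -
  have "A *\<^sub>v v = 0\<^sub>v m \<longleftrightarrow> (\<forall>b. apply_coefficients g' g A (component g b v) = 0)"
    if v: "v \<in> carrier_vec N" for v
  proof -
    have comp: "component g' b (A *\<^sub>v v) = apply_coefficients g' g A (component g b v)" for b
      using component_mult_mat_vec[OF A(1)] v A(2) by simp
    have zero: "component g' b (0\<^sub>v m) = 0" for b by (auto simp: component_def)
    have "A *\<^sub>v v = 0\<^sub>v m \<longleftrightarrow> (\<forall>b. component g' b (A *\<^sub>v v) = component g' b (0\<^sub>v m))"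
      using component_eqI[of "A *\<^sub>v v" m "0\<^sub>v m" g'] A(2) v by auto
    then show ?thesis by (simp add: comp zero)
  qed
  then have "mat_kernel A = {v \<in> carrier_vec N. \<forall>b. apply_coefficients g' g A (component g b v) = 0}"
    using A(2) by (auto simp: mat_kernel_def)
  moreover have "apply_coefficients g' g A 0 = 0" by (auto simp: apply_coefficients_def)
  ultimately show ?thesis
    using mat_image_eq_iff[OF B, of "\<lambda>b f. apply_coefficients g' g A f = 0"] by simp
qed

lemma augmentation_in_ideal_iff:
  assumes M: "\<And>p. p \<in> M \<longleftrightarrow> (\<forall>t \<in> keys p. lookup t \<in> I)"
    and hom: "\<And>c t. c < N \<Longrightarrow> t \<in> keys (u $ c) \<Longrightarrow> t = g c"
    and v: "v \<in> carrier_vec N"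
  shows "u \<bullet> v \<in> M \<longleftrightarrow>
    (\<forall>b. lookup b \<in> I \<or> (\<Sum>c<N. lookup (u $ c) (g c) * component g b v c) = 0)"
  using lookup_augmentation[of N u g v, OF hom v] unfolding M by (auto simp: in_keys_iff)

text \<open>
By this lemma the lower bound applies to every minimal multigraded resolution, in particular to the
one that defines the Betti numbers.
\<close>

lemma scalar_of_minimal_resolution:
  fixes M :: "('n::finite, 'k::field) mpoly set"
  assumes res: "minimal_multigraded_resolution M \<beta> d u g"
    and M: "\<And>p. p \<in> M \<longleftrightarrow> (\<forall>t \<in> keys p. lookup t \<in> I)"
    and upward: "\<And>b b'. b \<in> I \<Longrightarrow> b \<le> b' \<Longrightarrow> b' \<in> I"
  shows "scalar_resolution I \<beta> (\<lambda>p c. lookup (g p c))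
    (\<lambda>p. coefficient (g p) (g (Suc p)) (d p)) (\<lambda>c. lookup (u $ c) (g 0 c))"
proof -
  have d: "d p \<in> carrier_mat (\<beta> p) (\<beta> (Suc p))" for p
    using res by (simp add: minimal_multigraded_resolution_def free_resolution_def)
  have hom: "homogeneous_matrix (g p) (g (Suc p)) (d p)" for p
    using res d[of p] unfolding minimal_multigraded_resolution_def multigraded_def homogeneous_matrix_def
    by auto
  have min: "r < \<beta> p \<Longrightarrow> c < \<beta> (Suc p) \<Longrightarrow> lookup (d p $$ (r, c)) 0 = 0" for p r c
    using res unfolding minimal_multigraded_resolution_def minimal_differentials_def max_ideal_iff by blast
  have u: "\<And>c t. c < \<beta> 0 \<Longrightarrow> t \<in> keys (u $ c) \<Longrightarrow> t = g 0 c"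
    using res unfolding minimal_multigraded_resolution_def multigraded_def by blast
  have onto: "\<exists>v \<in> carrier_vec (\<beta> 0). s - u \<bullet> v \<in> M" for s
    using res unfolding minimal_multigraded_resolution_def free_resolution_def by blast
  have image_0: "mat_image (d 0) = {v \<in> carrier_vec (\<beta> 0). u \<bullet> v \<in> M}"
    and image_Suc: "mat_image (d (Suc p)) = mat_kernel (d p)" for p
    using res unfolding minimal_multigraded_resolution_def free_resolution_def by blast+
  let ?U = "\<lambda>c. lookup (u $ c) (g 0 c)"
  have apply_eq: "(\<lambda>r. \<Sum>c<\<beta> (Suc p). coefficient (g p) (g (Suc p)) (d p) r c * f c)
      = apply_coefficients (g p) (g (Suc p)) (d p) f" for p f
    using d[of p] by (simp add: apply_coefficients_def)
  show ?thesis
  proof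
    fix b b' assume "b \<in> I" "b \<le> b'" then show "b' \<in> I" by (rule upward)
  next
    fix p r c assume nz: "coefficient (g p) (g (Suc p)) (d p) r c \<noteq> 0"
    note le = homogeneous_coefficient_le[OF hom nz]
    have "lookup (g p r) \<noteq> lookup (g (Suc p) c)"
    proof
      assume "lookup (g p r) = lookup (g (Suc p) c)"
      then have "g (Suc p) c - g p r = 0" by (simp add: poly_mapping_eq_iff[symmetric])
      then show False using nz min[of r p c] le(1,2) d[of p] by (simp add: coefficient_def)
    qed
    then show "r < \<beta> p \<and> lookup (g p r) < lookup (g (Suc p) c)"
      using le(1,4) d[of p] by (metis carrier_matD(1) order.not_eq_order_implies_strict)
  next
    fix b assume b: "b \<notin> I"
    obtain b' where b': "lookup b' = b" using lookup_surj by blast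
    obtain v where v: "v \<in> carrier_vec (\<beta> 0)" "Poly_Mapping.single b' 1 - u \<bullet> v \<in> M" using onto by blast
    then have "b' \<notin> keys (Poly_Mapping.single b' 1 - u \<bullet> v)" using M b b' by blast
    then have "lookup (u \<bullet> v) b' = 1" by (simp add: in_keys_iff lookup_minus)
    then have "(\<Sum>c<\<beta> 0. ?U c * component (g 0) b' v c) \<noteq> 0"
      using lookup_augmentation[of "\<beta> 0" u "g 0" v b', OF u v(1)] by simp
    then show "\<exists>f \<in> strand (\<beta> 0) (\<lambda>c. lookup (g 0 c)) b. (\<Sum>c<\<beta> 0. ?U c * f c) \<noteq> 0"
      using component_in_strand[OF v(1), of "g 0" b'] b' by blast
  next
    fix f :: "nat \<Rightarrow> 'k" and b assume f: "f \<in> strand (\<beta> 0) (\<lambda>c. lookup (g 0 c)) b"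
    obtain b' where b': "lookup b' = b" using lookup_surj by blast
    have "mat_image (d 0) = {v \<in> carrier_vec (\<beta> 0). \<forall>b. lookup b \<in> I \<or>
        (\<Sum>c<\<beta> 0. ?U c * component (g 0) b v c) = 0}"
      unfolding image_0 using augmentation_in_ideal_iff[OF M u] by auto
    then have "\<forall>b. \<forall>f \<in> strand_of (\<beta> 0) (g 0) b.
        (\<exists>x \<in> strand_of (\<beta> 1) (g 1) b. apply_coefficients (g 0) (g 1) (d 0) x = f)
        \<longleftrightarrow> lookup b \<in> I \<or> (\<Sum>c<\<beta> 0. ?U c * f c) = 0"
      using mat_image_eq_iff[OF hom[of 0] d[of 0],
        of "\<lambda>b f. lookup b \<in> I \<or> (\<Sum>c<\<beta> 0. ?U c * f c) = 0"] by simp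
    then show "(\<exists>h \<in> strand (\<beta> 1) (\<lambda>c. lookup (g 1 c)) b.
        (\<lambda>r. \<Sum>c<\<beta> 1. coefficient (g 0) (g (Suc 0)) (d 0) r c * h c) = f)
        \<longleftrightarrow> b \<in> I \<or> (\<Sum>c<\<beta> 0. ?U c * f c) = 0"
      using f apply_eq[of 0] unfolding b'[symmetric] by simp
  next
    fix f :: "nat \<Rightarrow> 'k" and p b assume f: "f \<in> strand (\<beta> (Suc p)) (\<lambda>c. lookup (g (Suc p) c)) b"
    obtain b' where b': "lookup b' = b" using lookup_surj by blast
    show "(\<exists>h \<in> strand (\<beta> (Suc (Suc p))) (\<lambda>c. lookup (g (Suc (Suc p)) c)) b.
        (\<lambda>r. \<Sum>c<\<beta> (Suc (Suc p)). coefficient (g (Suc p)) (g (Suc (Suc p))) (d (Suc p)) r c * h c) = f)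
        \<longleftrightarrow> (\<lambda>r. \<Sum>c<\<beta> (Suc p). coefficient (g p) (g (Suc p)) (d p) r c * f c) = 0"
      using mat_image_eq_kernel_iff[OF hom[of p] d[of p] hom[of "Suc p"] d[of "Suc p"]] f
      unfolding apply_eq b'[symmetric] image_Suc by blast
  qed
qed

text \<open>
The converse translation, which turns the inductively constructed scalar matrices into a resolution
over the polynomial ring: the entry of \<open>d p\<close> is the scalar times the monomial forced by the degrees.
\<close>

lemma minimal_resolution_of_scalar:
  fixes M :: "('n::finite, 'k::field) mpoly set" and D :: "nat \<Rightarrow> nat \<Rightarrow> nat \<Rightarrow> 'k"
  assumes scalar: "scalar_resolution I \<beta> G D U"
    and M: "\<And>p. p \<in> M \<longleftrightarrow> (\<forall>t \<in> keys p. lookup t \<in> I)"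
  shows "\<exists>d u g. minimal_multigraded_resolution M \<beta> d u g"
proof -
  interpret scalar_resolution I \<beta> G D U by (rule scalar)
  define g where "g p c = Abs_poly_mapping (G p c)" for p c
  have lookup_g: "lookup (g p c) = G p c" for p c
    unfolding g_def by (rule lookup_Abs_poly_mapping) simp
  define u where "u = vec (\<beta> 0) (\<lambda>c. Poly_Mapping.single (g 0 c) (U c))"
  define d where "d p = mat (\<beta> p) (\<beta> (Suc p))
    (\<lambda>(r, c). Poly_Mapping.single (g (Suc p) c - g p r) (D p r c))" for p
  have d: "d p \<in> carrier_mat (\<beta> p) (\<beta> (Suc p))" for p by (simp add: d_def)
  have key: "D p r c \<noteq> 0 \<and> t = g (Suc p) c - g p r"
    if "t \<in> keys (d p $$ (r, c))" "r < \<beta> p" "c < \<beta> (Suc p)" for t p r c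
    using that by (auto simp: d_def split: if_splits)
  have D_deg: "g p r + (g (Suc p) c - g p r) = g (Suc p) c" if "D p r c \<noteq> 0" for p r c
    using minimal[OF that] by (intro add_diff_exponent) (auto simp: lookup_g)
  have hom: "homogeneous_matrix (g p) (g (Suc p)) (d p)" for p
    unfolding homogeneous_matrix_def
  proof (intro allI impI ballI)
    fix r c t assume "r < dim_row (d p)" "c < dim_col (d p)" "t \<in> keys (d p $$ (r, c))"
    then show "g p r + t = g (Suc p) c" using key[of t p r c] D_deg[of p r c] d[of p] by simp
  qed
  have coeff: "coefficient (g p) (g (Suc p)) (d p) r c = D p r c" if "c < \<beta> (Suc p)" for p r c
    using that minimal[of p r c] by (auto simp: coefficient_def d_def)
  have apply_eq: "apply_coefficients (g p) (g (Suc p)) (d p) f = (\<lambda>r. \<Sum>c<\<beta> (Suc p). D p r c * f c)" for p f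
    using d[of p] by (simp add: apply_coefficients_def coeff)
  have u: "u \<in> carrier_vec (\<beta> 0)" "\<And>c t. c < \<beta> 0 \<Longrightarrow> t \<in> keys (u $ c) \<Longrightarrow> t = g 0 c"
    by (auto simp: u_def split: if_splits)
  have U: "lookup (u $ c) (g 0 c) = U c" if "c < \<beta> 0" for c using that by (simp add: u_def)
  have aug: "lookup (u \<bullet> v) b = (\<Sum>c<\<beta> 0. U c * component (g 0) b v c)"
    if "v \<in> carrier_vec (\<beta> 0)" for v b
    using lookup_augmentation[of "\<beta> 0" u "g 0" v b, OF u(2) that] U by simp
  have "\<exists>v \<in> carrier_vec (\<beta> 0). s - u \<bullet> v \<in> M" for s
  proof -
    have "\<exists>f \<in> strand_of (\<beta> 0) (g 0) b. (lookup b \<notin> I \<longrightarrow> (\<Sum>c<\<beta> 0. U c * f c) = lookup s b) \<and>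
        (lookup s b = 0 \<longrightarrow> f = 0)" for b
    proof (cases "lookup b \<in> I \<or> lookup s b = 0")
      case True
      then show ?thesis by (intro bexI[of _ 0]) (auto simp: strand_def)
    next
      case False
      then obtain f where f: "f \<in> strand_of (\<beta> 0) (g 0) b" "(\<Sum>c<\<beta> 0. U c * f c) \<noteq> 0"
        using augmentation_onto[of "lookup b"] by (auto simp: lookup_g)
      \<comment> \<open>The degree \<open>b\<close> part of \<open>S/M\<close> is one-dimensional, so a multiple of \<open>f\<close> hits the coefficient of \<open>s\<close>.\<close>
      let ?a = "lookup s b / (\<Sum>c<\<beta> 0. U c * f c)"
      have "(\<Sum>c<\<beta> 0. U c * (?a * f c)) = ?a * (\<Sum>c<\<beta> 0. U c * f c)"
        unfolding sum_distrib_left by (intro sum.cong) auto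
      then have "(\<Sum>c<\<beta> 0. U c * (?a * f c)) = lookup s b" using f(2) by simp
      moreover have "(\<lambda>c. ?a * f c) \<in> strand_of (\<beta> 0) (g 0) b" using f(1) by (auto simp: strand_def)
      ultimately show ?thesis using False by (intro bexI[of _ "\<lambda>c. ?a * f c"]) simp_all
    qed
    then obtain f where f: "\<And>b. f b \<in> strand_of (\<beta> 0) (g 0) b"
      "\<And>b. lookup b \<notin> I \<Longrightarrow> (\<Sum>c<\<beta> 0. U c * f b c) = lookup s b" "\<And>b. lookup s b = 0 \<Longrightarrow> f b = 0"
      by metis
    have "{b. f b \<noteq> 0} \<subseteq> keys s" using f(3) by (auto simp: in_keys_iff)
    then have "finite {b. f b \<noteq> 0}" by (rule finite_subset) simp
    then have "\<exists>v \<in> carrier_vec (\<beta> 0). \<forall>b. component (g 0) b v = f b"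
      using f(1) by (rule assemble_components)
    then obtain v where v: "v \<in> carrier_vec (\<beta> 0)" "\<And>b. component (g 0) b v = f b" by blast
    have "lookup t \<in> I" if "t \<in> keys (s - u \<bullet> v)" for t
      using that aug[OF v(1), of t] f(2)[of t] by (auto simp: in_keys_iff lookup_minus v(2))
    then show ?thesis using M v(1) by blast
  qed
  moreover have "mat_image (d 0) = {v \<in> carrier_vec (\<beta> 0). u \<bullet> v \<in> M}"
  proof -
    have "mat_image (d 0) = {v \<in> carrier_vec (\<beta> 0). \<forall>b. lookup b \<in> I \<or>
        (\<Sum>c<\<beta> 0. U c * component (g 0) b v c) = 0}"
      by (subst mat_image_eq_iff[OF hom[of 0] d[of 0],
          where Q = "\<lambda>b f. lookup b \<in> I \<or> (\<Sum>c<\<beta> 0. U c * f c) = 0"])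
        (use exact_0 in \<open>auto simp: apply_eq lookup_g\<close>)
    also have "\<dots> = {v \<in> carrier_vec (\<beta> 0). u \<bullet> v \<in> M}"
      using augmentation_in_ideal_iff[OF M u(2)] by (auto simp: U)
    finally show ?thesis .
  qed
  moreover have "mat_image (d (Suc p)) = mat_kernel (d p)" for p
    unfolding mat_image_eq_kernel_iff[OF hom[of p] d[of p] hom[of "Suc p"] d[of "Suc p"]]
    using exact_Suc by (simp add: apply_eq lookup_g)
  moreover have "d p $$ (r, c) \<in> max_ideal" if "r < \<beta> p" "c < \<beta> (Suc p)" for p r c
    unfolding max_ideal_iff
  proof (rule ccontr)
    assume "lookup (d p $$ (r, c)) 0 \<noteq> 0"
    then have *: "D p r c \<noteq> 0" "0 = g (Suc p) c - g p r" using key[of 0] that by (auto simp: in_keys_iff)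
    then have "g p r = g (Suc p) c" using D_deg[OF *(1)] by simp
    then show False using minimal[OF *(1)] by (metis lookup_g less_irrefl)
  qed
  moreover have "g p r + t = g (Suc p) c"
    if "r < \<beta> p" "c < \<beta> (Suc p)" "t \<in> keys (d p $$ (r, c))" for p r c t
    using key[of t p r c] D_deg[of p r c] that by simp
  ultimately have "minimal_multigraded_resolution M \<beta> d u g"
    unfolding minimal_multigraded_resolution_def free_resolution_def multigraded_def
      minimal_differentials_def
    using u d by blast
  then show ?thesis by blast
qed

section \<open>The lower bound for the sum of the Betti numbers\<close>

theorem theorem6p8:
  fixes M :: "('n::finite, 'k::field) mpoly set"
  assumes "monomial_ideal M"
    and "proj_dim M = enat CARD('n)"
  shows "(\<Sum>i=0..CARD('n). betti M i) \<ge> 2 ^ CARD('n)"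
proof -
  obtain A where A: "M = ideal_gen (monom_of ` A)" using assms(1) by (auto simp: monomial_ideal_def)
  define I where "I = {b. \<exists>a \<in> A. lookup a \<le> b}"
  have M: "p \<in> M \<longleftrightarrow> (\<forall>t \<in> keys p. lookup t \<in> I)" for p
    by (simp add: A I_def ideal_gen_monomials)
  have upward: "b' \<in> I" if "b \<in> I" "b \<le> b'" for b b'
    using that unfolding I_def by (blast intro: order_trans)
  \<comment> \<open>Without a minimal resolution the choice in the definition of the Betti numbers would be arbitrary.\<close>
  have "\<exists>\<beta> G (D :: nat \<Rightarrow> nat \<Rightarrow> nat \<Rightarrow> 'k). scalar_resolution I \<beta> G D (\<lambda>_. 1)"
    by (rule scalar_resolution_ex) (rule upward)
  then obtain \<beta> G and D :: "nat \<Rightarrow> nat \<Rightarrow> nat \<Rightarrow> 'k" where "scalar_resolution I \<beta> G D (\<lambda>_. 1)"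
    by blast
  then have "\<exists>d u g. minimal_multigraded_resolution M \<beta> d u g"
    using M by (rule minimal_resolution_of_scalar)
  then have "\<exists>d u g. minimal_multigraded_resolution M (betti M) d u g"
    unfolding betti_def by (rule someI[where P = "\<lambda>\<beta>. \<exists>d u g. minimal_multigraded_resolution M \<beta> d u g"])
  then obtain d u g where "minimal_multigraded_resolution M (betti M) d u g" by blast
  then interpret scalar_resolution I "betti M" "\<lambda>p c. lookup (g p c)"
    "\<lambda>p. coefficient (g p) (g (Suc p)) (d p)" "\<lambda>c. lookup (u $ c) (g 0 c)"
    using M upward by (rule scalar_of_minimal_resolution)
  let ?S = "{i. betti M i \<noteq> 0}"
  have sup: "Sup (enat ` ?S) = enat CARD('n)" using assms(2) by (simp add: proj_dim_def)
  have vanish: "betti M p = 0" if "CARD('n) < p" for p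
  proof (rule ccontr)
    assume "betti M p \<noteq> 0"
    then have "enat p \<le> Sup (enat ` ?S)" by (intro Sup_upper) auto
    then show False using that unfolding sup by simp
  qed
  have "?S \<subseteq> {..CARD('n)}" using vanish by (force simp: not_less[symmetric])
  then have fin: "finite (enat ` ?S)" by (meson finite_atMost finite_imageI finite_subset)
  \<comment> \<open>The supremum of a finite nonempty set is attained; the empty set would have supremum \<open>0 < n\<close>.\<close>
  have "?S \<noteq> {}"
  proof
    assume "?S = {}"
    then have "enat CARD('n) = 0" unfolding sup[symmetric] by (simp add: bot_enat_def)
    then show False by (simp add: zero_enat_def)
  qed
  then have "Sup (enat ` ?S) \<in> enat ` ?S"
    using fin by (simp add: Sup_enat_def)
  then have "0 < betti M CARD('n)" unfolding sup by auto
  then show ?thesis using vanish by (rule sum_ranks_ge)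
qed

end
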